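(* Let $\mathcal{Q}$ be a regular $3$-polytope with $F$ facets circumscribed about a sphere of radius $1$ in $\mathbb{R}^3$. Let $t_1,\dots,t_k$ be the distinct lengths of the line segments whose endpoints are centers of two distinct facets of $\mathcal{Q}$ (so $k$ is the number of such distinct lengths). 1. If $\mathcal{Q}$ is a tetrahedron, then $\sum_{i=1}^{k}t_i^2\in\mathbb{Q}$. 2. If $\mathcal{Q}$ is an octahedron or a cube, then $\sum_{i=1}^{k}t_i^2=F$. 3. If $\mathcal{Q}$ is an icosahedron or a dodecahedron, then $\sum_{i=1}^{k}t_i^2=2k+2$.
   Context: A regular $3$-polytope is one of the five regular convex polyhedra (tetrahedron, octahedron, cube, icosahedron, dodecahedron, all regular). Its facets are its $2$-dimensional faces. It is circumscribed about a sphere if all its facets are tangent to the sphere (they touch the sphere at their centers, and the sphere's center is the center of the polytope). *)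

theory Defs
  imports "HOL-Analysis.Analysis"
begin

(* The n vertices are equally spaced on the circle with centre c and radius r in the plane
   through c spanned by the orthonormal pair u, w. Two regular n-gons with the same
   circumradius r are congruent. *)
definition regular_polygon :: "nat \<Rightarrow> real \<Rightarrow> 'a::euclidean_space set \<Rightarrow> bool" where
  "regular_polygon n r S \<longleftrightarrow> n \<ge> 3 \<and> r > 0 \<and>
     (\<exists>c u w. norm u = 1 \<and> norm w = 1 \<and> u \<bullet> w = 0 \<and>
        S = convex hull ((\<lambda>i. c + (r * cos (2 * pi * real i / real n)) *\<^sub>R u
                                + (r * sin (2 * pi * real i / real n)) *\<^sub>R w) ` {..<n}))"

(* Three-dimensional convex polytopes whose facets are mutually congruent regular p-gons,
   with exactly q facets meeting at every vertex; (p, q) is the Schlaefli symbol. *)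
definition regular_polyhedron :: "nat \<Rightarrow> nat \<Rightarrow> (real^3) set \<Rightarrow> bool" where
  "regular_polyhedron p q Q \<longleftrightarrow> polytope Q \<and> aff_dim Q = 3 \<and>
     (\<exists>r. \<forall>f. f facet_of Q \<longrightarrow> regular_polygon p r f) \<and>
     (\<forall>v. v extreme_point_of Q \<longrightarrow> card {f. f facet_of Q \<and> v \<in> f} = q)"

definition regular_tetrahedron :: "(real^3) set \<Rightarrow> bool" where
  "regular_tetrahedron = regular_polyhedron 3 3"

definition regular_octahedron :: "(real^3) set \<Rightarrow> bool" where
  "regular_octahedron = regular_polyhedron 3 4"

definition regular_cube :: "(real^3) set \<Rightarrow> bool" where
  "regular_cube = regular_polyhedron 4 3"

definition regular_icosahedron :: "(real^3) set \<Rightarrow> bool" where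
  "regular_icosahedron = regular_polyhedron 3 5"

definition regular_dodecahedron :: "(real^3) set \<Rightarrow> bool" where
  "regular_dodecahedron = regular_polyhedron 5 3"

definition regular_3_polytope :: "(real^3) set \<Rightarrow> bool" where
  "regular_3_polytope Q \<longleftrightarrow> regular_tetrahedron Q \<or> regular_octahedron Q \<or> regular_cube Q \<or>
     regular_icosahedron Q \<or> regular_dodecahedron Q"

(* The centroid of the vertices, used both for a polytope and for its facets; for a regular
   polygon it is the centre of the circumscribed circle. *)
definition polytope_center :: "'a::euclidean_space set \<Rightarrow> 'a" where
  "polytope_center S =
     (\<Sum>v\<in>{v. v extreme_point_of S}. v) /\<^sub>R real (card {v. v extreme_point_of S})"

(* A plane is tangent to a sphere iff it meets the sphere in a single point; here that point
   has to be the centre of the facet spanning the plane. *)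
definition circumscribed_about :: "(real^3) set \<Rightarrow> real^3 \<Rightarrow> real \<Rightarrow> bool" where
  "circumscribed_about Q z \<rho> \<longleftrightarrow> z = polytope_center Q \<and>
     (\<forall>f. f facet_of Q \<longrightarrow> affine hull f \<inter> sphere z \<rho> = {polytope_center f})"

definition facet_center_distances :: "(real^3) set \<Rightarrow> real set" where
  "facet_center_distances Q =
     {dist (polytope_center f) (polytope_center g) | f g. f facet_of Q \<and> g facet_of Q \<and> f \<noteq> g}"

end

theory Submission
  imports Defs
begin

text \<open>
Put the centre of the sphere at the origin. Each facet is then described by its unit normal \<open>n\<close>,
which is also its centre, and the squared distance of two facet centres is \<open>2 - 2 (m \<bullet> n)\<close>. So
everything is a statement about the finite set of normals, and two facts about it carry the proof.

\<^item> If the normals are symmetric about the origin, then the set of inner products of distinct normals,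
  enlarged by the value 1, is closed under negation and sums to 0. Hence the inner products themselves
  sum to -1, and the \<open>k\<close> squared distances sum to \<open>2 k + 2\<close> (\<open>sum_distances_symmetric\<close>). For the
  icosahedron and the dodecahedron this is the claim; for the cube and the octahedron it remains to
  see that \<open>2 k + 2\<close> equals the number of facets.

\<^item> All the solids except the tetrahedron have symmetric normals (\<open>normals_symmetric\<close>). Attach to a facet
  and one of its edges the orthonormal frame \<open>(n, b, d)\<close> of the facet normal, the direction from the
  facet centre to the midpoint of the edge, and the direction of the edge. Rotating the facet about its
  centre, reversing the edge and crossing the edge to the adjacent facet turn such a frame into another
  one, each by a fixed linear substitution. The composite of a rotation by one step and a crossing is
  a Coxeter element \<open>K\<close> of the symmetry group, and its characteristic equation is
  \<open>K^3 = t (K^2 + K) - 1\<close> with a single parameter \<open>t\<close>. If \<open>t = 0\<close> then \<open>K^3 = -1\<close>, and if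
  \<open>t^2 + t = 1\<close> then \<open>K^5 = -1\<close>; in both cases every normal has its opposite among the normals. The cube and the
  octahedron have \<open>t = 0\<close>, the dodecahedron and the icosahedron have \<open>t^2 + t = 1\<close>.

For facets with \<open>p\<close> edges, \<open>t\<close> is fixed by the number \<open>q\<close> of facets at a vertex
(\<open>\<tau>_value\<close>). Crossing the edges at
a vertex one after the other produces normals that lie on a circle and advance by a constant angle
\<open>\<theta>\<close>. These are all the normals at the vertex (\<open>normals_at_vertex\<close>): a normal \<open>m\<close> at the vertex is
compared with the produced normal closest to it, and since crossing either edge there does not come closer
to \<open>m\<close>, while no vertex lies beyond the plane of \<open>m\<close>, the two agree. So \<open>q \<theta>\<close> is a multiple of the
full turn and no smaller positive multiple of \<open>\<theta>\<close> is one.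
This determines \<open>2 cos \<theta>\<close> for \<open>q = 3\<close> and \<open>q = 4\<close>, and up to algebraic
conjugation for \<open>q = 5\<close>. The conjugate value, that of the pentagram, gives the same equation for \<open>t\<close>,
so that it need not be excluded.

For the tetrahedron, the cube and the octahedron the normals are found from the inequalities
\<open>m \<bullet> v \<le> 1\<close>, which every normal \<open>m\<close> satisfies for every vertex \<open>v\<close>.
\<close>

section \<open>Regular polygons\<close>

text \<open>
With \<open>b\<close> and \<open>d\<close> orthonormal, \<open>ray b d \<theta>\<close> is the unit vector at angle \<open>\<theta>\<close> from \<open>b\<close>, and passing to the
pair \<open>ray b d \<theta>\<close>, \<open>ray b d (\<theta> + pi / 2)\<close> rotates the coordinate axes.
\<close>
definition ray :: "'a::real_vector \<Rightarrow> 'a \<Rightarrow> real \<Rightarrow> 'a" where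
  "ray b d \<theta> = cos \<theta> *\<^sub>R b + sin \<theta> *\<^sub>R d"

lemma ray_ray: "ray (ray b d \<theta>) (ray b d (\<theta> + pi / 2)) \<phi> = ray b d (\<theta> + \<phi>)"
  by (simp add: ray_def cos_add sin_add algebra_simps)

lemma ray_reflect: "ray b (- d) \<phi> = ray b d (- \<phi>)"
  by (simp add: ray_def)

lemma ray_periodic: "ray b d (\<theta> + 2 * pi * real_of_int k) = ray b d \<theta>"
proof -
  have "cos (2 * pi * real_of_int k) = 1"
    by (simp add: cos_one_2pi_int mult.commute)
  moreover have "sin (2 * pi * real_of_int k) = 0"
    by (metis mult.assoc mult.commute sin_int_2pin)
  ultimately show ?thesis
    by (simp add: ray_def cos_add sin_add)
qed

lemma norm_ray:
  fixes b d :: "'a::real_inner"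
  assumes "norm b = 1" "norm d = 1" "b \<bullet> d = 0"
  shows "norm (ray b d \<theta>) = 1"
proof -
  have "(norm (ray b d \<theta>))\<^sup>2 = (cos \<theta>)\<^sup>2 * (b \<bullet> b) + (sin \<theta>)\<^sup>2 * (d \<bullet> d)"
    using assms(3)
    unfolding power2_norm_eq_inner ray_def
    by (simp add: inner_simps inner_commute power2_eq_square)
  also have "\<dots> = 1"
    using assms(1,2) by (simp flip: power2_norm_eq_inner)
  finally show ?thesis
    using norm_ge_zero[of "ray b d \<theta>"] by (auto simp: power2_eq_1_iff)
qed

text \<open>
The axis \<open>b\<close> points to the midpoint of an edge, so that the endpoints of this edge, which have the indices
0 and -1, are mirror images of each other. Indexing by all integers makes the symmetries of the polygon
shifts and reflections of the index.
\<close>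
definition polygon_vertices ::
  "nat \<Rightarrow> real \<Rightarrow> 'a::real_vector \<Rightarrow> 'a \<Rightarrow> 'a \<Rightarrow> 'a set" where
  "polygon_vertices p r c b d =
     range (\<lambda>i::int. c + r *\<^sub>R ray b d ((2 * of_int i + 1) * pi / real p))"

lemma ray_mod:
  assumes "p > 0"
  shows "ray b d (\<theta> + 2 * pi * of_int (i mod int p) / real p) =
    ray b d (\<theta> + 2 * pi * of_int i / real p)"
proof -
  have "real_of_int i = real p * of_int (i div int p) + of_int (i mod int p)"
    by (metis mult_div_mod_eq of_int_add of_int_mult of_int_of_nat_eq)
  then have "\<theta> + 2 * pi * of_int i / real p =
      (\<theta> + 2 * pi * of_int (i mod int p) / real p) + 2 * pi * of_int (i div int p)"
    using assms by (simp add: field_simps)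
  then show ?thesis
    by (metis ray_periodic)
qed

lemma range_ray_eq:
  assumes "p > 0"
  shows "range (\<lambda>i::int. ray b d (\<theta> + 2 * pi * of_int i / real p)) =
    (\<lambda>i::nat. ray b d (\<theta> + 2 * pi * real i / real p)) ` {..<p}"
proof (intro equalityI subsetI)
  fix x assume "x \<in> range (\<lambda>i::int. ray b d (\<theta> + 2 * pi * of_int i / real p))"
  then obtain i :: int where x: "x = ray b d (\<theta> + 2 * pi * of_int i / real p)"
    by auto
  have "real (nat (i mod int p)) = of_int (i mod int p)" "nat (i mod int p) < p"
    using assms by (auto simp: nat_less_iff)
  then show "x \<in> (\<lambda>i::nat. ray b d (\<theta> + 2 * pi * real i / real p)) ` {..<p}"
    using ray_mod[OF assms, of b d \<theta> i] x by (metis (no_types, lifting) imageI lessThan_iff)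
next
  fix x assume "x \<in> (\<lambda>i::nat. ray b d (\<theta> + 2 * pi * real i / real p)) ` {..<p}"
  then obtain i :: nat where "x = ray b d (\<theta> + 2 * pi * real i / real p)"
    by auto
  then have "x = ray b d (\<theta> + 2 * pi * of_int (int i) / real p)"
    by simp
  then show "x \<in> range (\<lambda>i::int. ray b d (\<theta> + 2 * pi * of_int i / real p))"
    by blast
qed

lemma polygon_vertices_alt:
  "polygon_vertices p r c b d =
    (\<lambda>x. c + r *\<^sub>R x) ` range (\<lambda>i::int. ray b d (pi / real p + 2 * pi * of_int i / real p))"
proof -
  have "(2 * of_int i + 1) * pi / real p = pi / real p + 2 * pi * of_int i / real p" for i :: int
    by (simp add: add_divide_distrib distrib_right)
  then show ?thesis
    by (simp add: polygon_vertices_def image_image)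
qed

lemma finite_polygon_vertices: "p > 0 \<Longrightarrow> finite (polygon_vertices p r c b d)"
  unfolding polygon_vertices_alt range_ray_eq by blast

lemma polygon_vertices_rotate:
  assumes "p > 0"
  shows "polygon_vertices p r c (ray b d (2 * pi * of_int k / real p))
      (ray b d (2 * pi * of_int k / real p + pi / 2)) = polygon_vertices p r c b d"
proof -
  have *: "2 * pi * of_int k / real p + (2 * of_int i + 1) * pi / real p =
      (2 * of_int (i + k) + 1) * pi / real p" for i :: int
    using assms by (simp add: field_simps)
  have "polygon_vertices p r c (ray b d (2 * pi * of_int k / real p))
      (ray b d (2 * pi * of_int k / real p + pi / 2)) =
      (\<lambda>i::int. c + r *\<^sub>R ray b d ((2 * of_int i + 1) * pi / real p)) ` range (\<lambda>i. i + k)"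
    by (simp only: polygon_vertices_def ray_ray * image_image)
  also have "range (\<lambda>i. i + k) = UNIV"
    by (metis diff_add_cancel surjI)
  finally show ?thesis
    by (simp add: polygon_vertices_def)
qed

lemma polygon_vertices_reflect:
  "polygon_vertices p r c b (- d) = polygon_vertices p r c b d"
proof -
  have *: "- ((2 * of_int i + 1) * pi / real p) = (2 * of_int (- 1 - i) + 1) * pi / real p" for i :: int
    by (cases "p = 0") (simp_all add: field_simps)
  have "polygon_vertices p r c b (- d) =
      (\<lambda>i::int. c + r *\<^sub>R ray b d ((2 * of_int i + 1) * pi / real p)) ` range (\<lambda>i. - 1 - i)"
    by (simp only: polygon_vertices_def ray_reflect * image_image)
  also have "range (\<lambda>i::int. - 1 - i) = UNIV"
    by (rule surjI[of _ "\<lambda>i. - 1 - i"]) simp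
  finally show ?thesis
    by (simp add: polygon_vertices_def)
qed

text \<open>A ball is strictly convex, so no point of a sphere lies between two points of the ball.\<close>
lemma extreme_points_hull_of_sphere_subset:
  fixes V :: "'a::euclidean_space set"
  assumes "V \<subseteq> sphere c r"
  shows "{x. x extreme_point_of (convex hull V)} = V"
proof (intro equalityI subsetI)
  fix v assume v: "v \<in> V"
  have hull: "convex hull V \<subseteq> cball c r"
    by (rule hull_minimal) (use assms in auto)
  have "\<not> v \<in> open_segment x y" if "x \<in> convex hull V" "y \<in> convex hull V" for x y
  proof
    assume "v \<in> open_segment x y"
    then have "dist c v < dist c x \<or> dist c v < dist c y"
      by (rule dist_decreases_open_segment)
    moreover have "dist c x \<le> r" "dist c y \<le> r"
      using that hull by auto
    moreover have "dist c v = r"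
      using v assms by auto
    ultimately show False
      by linarith
  qed
  then show "v \<in> {x. x extreme_point_of (convex hull V)}"
    using v by (simp add: extreme_point_of_def hull_inc)
qed (use extreme_point_of_convex_hull in blast)

lemma polygon_vertices_sphere:
  fixes b d :: "'a::real_inner"
  assumes "norm b = 1" "norm d = 1" "b \<bullet> d = 0" "r \<ge> 0"
  shows "polygon_vertices p r c b d \<subseteq> sphere c r"
  using assms by (auto simp: polygon_vertices_def dist_norm norm_ray)

lemma polygon_vertices_roots_of_unity:
  fixes c u w :: "'a::real_vector"
  assumes "p > 0"
  shows "(\<lambda>i. c + (r * cos (2 * pi * real i / real p)) *\<^sub>R u
            + (r * sin (2 * pi * real i / real p)) *\<^sub>R w) ` {..<p} =
    (\<lambda>\<zeta>. c + r *\<^sub>R (Re \<zeta> *\<^sub>R u + Im \<zeta> *\<^sub>R w)) ` {\<zeta>. \<zeta> ^ p = 1}"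
proof -
  have "{\<zeta>. \<zeta> ^ p = 1} = (\<lambda>k. cis (2 * pi * real k / real p)) ` {..<p}"
    using Complex.bij_betw_roots_unity[OF assms] by (simp add: bij_betw_def)
  then show ?thesis
    by (simp add: image_image scaleR_add_right add.assoc)
qed

text \<open>The vertices are an affine image of the roots of unity, whose sum is 0.\<close>
lemma sum_polygon_vertices:
  fixes c u w :: "'a::real_inner"
  assumes "p > 1" "r \<noteq> 0" and uw: "norm u = 1" "norm w = 1" "u \<bullet> w = 0"
  defines "V \<equiv> (\<lambda>i. c + (r * cos (2 * pi * real i / real p)) *\<^sub>R u
            + (r * sin (2 * pi * real i / real p)) *\<^sub>R w) ` {..<p}"
  shows "card V = p" "(\<Sum>v\<in>V. v) = real p *\<^sub>R c"
proof -
  let ?Z = "{\<zeta>::complex. \<zeta> ^ p = 1}"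
  let ?g = "\<lambda>\<zeta>. c + r *\<^sub>R (Re \<zeta> *\<^sub>R u + Im \<zeta> *\<^sub>R w)"
  have V: "V = ?g ` ?Z"
    unfolding V_def by (rule polygon_vertices_roots_of_unity) (use assms(1) in simp)
  have inj: "inj_on ?g ?Z"
  proof (rule inj_onI)
    fix \<zeta> \<xi> assume "?g \<zeta> = ?g \<xi>"
    then have eq: "Re \<zeta> *\<^sub>R u + Im \<zeta> *\<^sub>R w = Re \<xi> *\<^sub>R u + Im \<xi> *\<^sub>R w"
      using assms(2) by simp
    have uu: "u \<bullet> u = 1" "w \<bullet> w = 1" "w \<bullet> u = 0"
      using uw by (simp_all add: inner_commute flip: power2_norm_eq_inner)
    have "(Re \<zeta> *\<^sub>R u + Im \<zeta> *\<^sub>R w) \<bullet> u = Re \<zeta>" "(Re \<zeta> *\<^sub>R u + Im \<zeta> *\<^sub>R w) \<bullet> w = Im \<zeta>" for \<zeta>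
      using uu uw by (simp_all add: inner_simps)
    then show "\<zeta> = \<xi>"
      using eq by (metis complex_eqI)
  qed
  have card: "card ?Z = p"
    using assms(1) by (simp add: card_roots_unity_eq)
  then show "card V = p"
    using V inj by (simp add: card_image)
  have "(\<Sum>v\<in>V. v) = (\<Sum>\<zeta>\<in>?Z. ?g \<zeta>)"
    using inj by (simp add: V sum.reindex)
  also have "\<dots> = real p *\<^sub>R c + r *\<^sub>R (Re (\<Sum>?Z) *\<^sub>R u + Im (\<Sum>?Z) *\<^sub>R w)"
    by (simp only: sum.distrib sum_constant_scaleR card Re_sum Im_sum scaleR_sum_left
        flip: scaleR_sum_right)
  also have "\<dots> = real p *\<^sub>R c"
    using sum_roots_unity[OF assms(1)] by simp
  finally show "(\<Sum>v\<in>V. v) = real p *\<^sub>R c" .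
qed

lemma polygon_vertices_nat:
  assumes "p > 0"
  shows "polygon_vertices p r c b d =
    (\<lambda>i. c + (r * cos (2 * pi * real i / real p)) *\<^sub>R ray b d (pi / real p)
            + (r * sin (2 * pi * real i / real p)) *\<^sub>R ray b d (pi / real p + pi / 2)) ` {..<p}"
proof -
  have *: "c + (r * cos \<phi>) *\<^sub>R ray b d (pi / real p)
            + (r * sin \<phi>) *\<^sub>R ray b d (pi / real p + pi / 2) =
      c + r *\<^sub>R ray b d (pi / real p + \<phi>)" for \<phi>
  proof -
    have "ray b d (pi / real p + \<phi>) =
        cos \<phi> *\<^sub>R ray b d (pi / real p) + sin \<phi> *\<^sub>R ray b d (pi / real p + pi / 2)"
      using ray_ray[of b d "pi / real p" \<phi>] by (metis ray_def)
    then show ?thesis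
      by (simp add: scaleR_add_right add.assoc)
  qed
  show ?thesis
    unfolding polygon_vertices_alt range_ray_eq[OF assms] image_image * ..
qed

lemma orthonormal_ray:
  fixes b d :: "'a::real_inner"
  assumes "norm b = 1" "norm d = 1" "b \<bullet> d = 0"
  shows "ray b d \<theta> \<bullet> ray b d (\<theta> + pi / 2) = 0"
proof -
  have "b \<bullet> b = 1" "d \<bullet> d = 1" "d \<bullet> b = 0"
    using assms by (simp_all add: inner_commute norm_eq_1)
  then show ?thesis
    using assms by (simp add: ray_def inner_simps cos_add sin_add)
qed

lemma polytope_center_polygon:
  fixes b d :: "'a::euclidean_space"
  assumes "p > 1" "r > 0" and bd: "norm b = 1" "norm d = 1" "b \<bullet> d = 0"
  shows "polytope_center (convex hull polygon_vertices p r c b d) = c"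
proof -
  let ?V = "polygon_vertices p r c b d"
  have ext: "{v. v extreme_point_of (convex hull ?V)} = ?V"
    by (rule extreme_points_hull_of_sphere_subset[OF polygon_vertices_sphere[OF bd]])
      (use assms in simp)
  have "p > 0" "r \<noteq> 0"
    using assms by auto
  note V = polygon_vertices_nat[OF \<open>p > 0\<close>, of r c b d]
  have "card ?V = p" "(\<Sum>v\<in>?V. v) = real p *\<^sub>R c"
    unfolding V
    by (rule sum_polygon_vertices[OF \<open>p > 1\<close> \<open>r \<noteq> 0\<close> norm_ray[OF bd] norm_ray[OF bd] orthonormal_ray[OF bd]])+
  then show ?thesis
    using \<open>p > 0\<close> by (simp add: polytope_center_def ext)
qed

text \<open>
The definition of a regular polygon places a vertex on its first axis. Turning the axes back by half a step
makes it point to the midpoint of an edge; the centre of the circle is the centroid of the vertices.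
\<close>
lemma regular_polygonE:
  fixes S :: "'a::euclidean_space set"
  assumes "regular_polygon p r S"
  obtains b d where "p \<ge> 3" "r > 0" "norm b = 1" "norm d = 1" "b \<bullet> d = 0"
    "S = convex hull polygon_vertices p r (polytope_center S) b d"
proof -
  obtain c u w where p: "p \<ge> 3" "r > 0" and uw: "norm u = 1" "norm w = 1" "u \<bullet> w = 0"
    and S: "S = convex hull ((\<lambda>i. c + (r * cos (2 * pi * real i / real p)) *\<^sub>R u
            + (r * sin (2 * pi * real i / real p)) *\<^sub>R w) ` {..<p})"
    using assms unfolding regular_polygon_def by auto
  define b where "b = ray u w (- pi / real p)"
  define d where "d = ray u w (- pi / real p + pi / 2)"
  have bd: "norm b = 1" "norm d = 1" "b \<bullet> d = 0"
    unfolding b_def d_def by (rule norm_ray[OF uw] orthonormal_ray[OF uw])+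
  have "ray b d (pi / real p) = u" "ray b d (pi / real p + pi / 2) = w"
    unfolding b_def d_def ray_ray by (simp_all add: ray_def)
  then have S': "S = convex hull polygon_vertices p r c b d"
    using S p polygon_vertices_nat[of p r c b d] by simp
  then have "polytope_center S = c"
    using polytope_center_polygon[OF _ _ bd] p by simp
  then show thesis
    using that[OF p bd] S' by simp
qed

text \<open>
Each edge lies on a supporting line of the polygon: apart from its two endpoints, all vertices are strictly
on the inner side.
\<close>
lemma polygon_edge_index:
  fixes i :: int
  assumes p: "p \<ge> 3" and b: "norm b = 1" "norm d = 1" "b \<bullet> d = 0"
  defines "v \<equiv> ray b d ((2 * of_int i + 1) * pi / real p)"
  shows "v = ray b d (pi / real p) \<or> v = ray b d (- pi / real p) \<or> v \<bullet> b < cos (pi / real p)"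
proof -
  define j where "j = i mod int p"
  have j: "0 \<le> j" "j < int p"
    using p by (auto simp: j_def)
  have "(2 * of_int i + 1) * pi / real p = pi / real p + 2 * pi * of_int i / real p"
    by (simp add: add_divide_distrib distrib_right)
  then have v: "v = ray b d (pi / real p + 2 * pi * of_int j / real p)"
    using ray_mod[of p b d "pi / real p" i] p by (simp add: v_def j_def)
  have bb: "b \<bullet> b = 1" "d \<bullet> b = 0"
    using b by (simp_all add: inner_commute flip: power2_norm_eq_inner)
  define \<theta> where "\<theta> = pi / real p + 2 * pi * of_int j / real p"
  have vb: "v \<bullet> b = cos \<theta>"
    using bb by (simp add: v \<theta>_def ray_def inner_simps)
  consider "j = 0" | "j = int p - 1" | "1 \<le> j" "j \<le> int p - 2"
    using j by linarith
  then show ?thesis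
  proof cases
    case 1
    then show ?thesis
      using v by simp
  next
    case 2
    then have "real_of_int j = real p - 1"
      by simp
    then have "\<theta> = - pi / real p + 2 * pi * of_int 1"
      using p by (simp add: \<theta>_def diff_divide_distrib right_diff_distrib)
    moreover have "v = ray b d \<theta>"
      by (simp add: v \<theta>_def)
    ultimately have "v = ray b d (- pi / real p)"
      using ray_periodic[of b d "- pi / real p" 1] by simp
    then show ?thesis
      by simp
  next
    case 3
    have pp: "real p > 0" using p by simp
    have j1: "real_of_int j \<ge> 1" "real_of_int j \<le> real p - 2"
      using 3 by linarith+
    have lo: "\<theta> > pi / real p"
      using j1 pp by (simp add: \<theta>_def)
    have "pi * real_of_int j \<le> pi * (real p - 2)"
      using j1 by (intro mult_left_mono) auto
    moreover have "\<theta> * real p = pi + 2 * (pi * real_of_int j)"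
      using pp by (simp add: \<theta>_def distrib_right)
    ultimately have "\<theta> * real p \<le> pi * (2 * real p - 3)"
      by (simp add: right_diff_distrib)
    also have "\<dots> < pi * (2 * real p - 1)"
      by simp
    finally have hi: "2 * pi - \<theta> > pi / real p"
      using pp by (simp add: field_simps)
    have "cos \<theta> < cos (pi / real p)"
    proof (cases "\<theta> \<le> pi")
      case True
      then show ?thesis
        using lo pp by (intro cos_monotone_0_pi) auto
    next
      case False
      then have "cos (2 * pi - \<theta>) < cos (pi / real p)"
        using hi pp by (intro cos_monotone_0_pi) auto
      then show ?thesis
        by simp
    qed
    then show ?thesis
      using vb by simp
  qed
qed

section \<open>Orthonormal frames in space\<close>

definition orthonormal_frame :: "real^3 \<Rightarrow> real^3 \<Rightarrow> real^3 \<Rightarrow> bool" where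
  "orthonormal_frame n b d \<longleftrightarrow> n \<bullet> n = 1 \<and> b \<bullet> b = 1 \<and> d \<bullet> d = 1 \<and> n \<bullet> b = 0 \<and> n \<bullet> d = 0 \<and> b \<bullet> d = 0"

lemma orthonormal_frameD:
  assumes "orthonormal_frame n b d"
  shows "n \<bullet> n = 1" "b \<bullet> b = 1" "d \<bullet> d = 1" "n \<bullet> b = 0" "n \<bullet> d = 0" "b \<bullet> d = 0"
    "b \<bullet> n = 0" "d \<bullet> n = 0" "d \<bullet> b = 0" "norm n = 1" "norm b = 1" "norm d = 1"
  using assms by (simp_all add: orthonormal_frame_def inner_commute norm_eq_sqrt_inner)

text \<open>Three orthonormal vectors span the space, and a vector orthogonal to all three of them vanishes.\<close>
lemma orthonormal_frame_expand:
  assumes "orthonormal_frame n b d"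
  shows "x = (x \<bullet> n) *\<^sub>R n + (x \<bullet> b) *\<^sub>R b + (x \<bullet> d) *\<^sub>R d"
proof -
  note o = orthonormal_frameD[OF assms]
  have ne: "n \<noteq> b" "n \<noteq> d" "b \<noteq> d" "0 \<notin> {n, b, d}"
    using o by auto
  have "pairwise orthogonal {n, b, d}"
    using o by (auto simp: pairwise_def orthogonal_def)
  then have ind: "independent {n, b, d}"
    using ne pairwise_orthogonal_independent by blast
  have "dim {n, b, d} = DIM(real^3)"
    using ne dim_eq_card_independent[OF ind] by simp
  then have span: "span {n, b, d} = UNIV"
    using dim_eq_full by blast
  define y where "y = x - ((x \<bullet> n) *\<^sub>R n + (x \<bullet> b) *\<^sub>R b + (x \<bullet> d) *\<^sub>R d)"
  have "orthogonal y e" if "e \<in> {n, b, d}" for e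
    using that o by (auto simp: orthogonal_def y_def inner_simps)
  then have "orthogonal y y"
    using orthogonal_to_span[of y "{n, b, d}" y] span by auto
  then have "y = 0"
    by (simp add: orthogonal_def)
  then show ?thesis
    by (simp add: y_def)
qed

lemma orthonormal_frame_inner:
  assumes "orthonormal_frame n b d"
  shows "x \<bullet> y = (x \<bullet> n) * (y \<bullet> n) + (x \<bullet> b) * (y \<bullet> b) + (x \<bullet> d) * (y \<bullet> d)"
proof -
  have "x \<bullet> y = x \<bullet> ((y \<bullet> n) *\<^sub>R n + (y \<bullet> b) *\<^sub>R b + (y \<bullet> d) *\<^sub>R d)"
    using orthonormal_frame_expand[OF assms, of y] by simp
  then show ?thesis
    by (simp add: inner_simps mult.commute)
qed

lemma orthonormal_frame_rotate:
  assumes "orthonormal_frame n b d"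
  shows "orthonormal_frame n (ray b d \<theta>) (ray b d (\<theta> + pi / 2))"
proof -
  note o = orthonormal_frameD[OF assms]
  have 1: "cos \<theta> * cos \<theta> + sin \<theta> * sin \<theta> = 1"
    using sin_cos_squared_add2[of \<theta>] by (simp add: power2_eq_square add.commute)
  show ?thesis
    using o 1 by (simp add: orthonormal_frame_def ray_def inner_simps cos_add sin_add)
qed

section \<open>The facets of a solid tangent to the unit sphere\<close>

text \<open>
The solid has Schlaefli symbol \<open>(p, q)\<close>, and \<open>r\<close> is the circumradius of its facets. The types of solids differ
only in the values of \<open>p\<close> and \<open>q\<close>.
\<close>
locale regular_solid =
  fixes Q :: "(real^3) set" and z :: "real^3" and p q :: nat and r :: real
  assumes polytope: "polytope Q" and aff_dim: "aff_dim Q = 3"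
    and polygon: "\<And>f. f facet_of Q \<Longrightarrow> regular_polygon p r f"
    and degree: "\<And>v. v extreme_point_of Q \<Longrightarrow> card {f. f facet_of Q \<and> v \<in> f} = q"
    and circumscribed: "circumscribed_about Q z 1"
begin

lemma convex: "convex Q"
  by (simp add: polytope polytope_imp_convex)

lemma facet_exists: "\<exists>f. f facet_of Q"
  using polytope_facet_exists[OF polytope] aff_dim by auto

lemma p_ge_3: "p \<ge> 3" and r_pos: "r > 0"
  using facet_exists polygon unfolding regular_polygon_def by blast+

text \<open>The apothem of a facet, and half the length of its edges.\<close>
definition a where "a = r * cos (pi / real p)"
definition l where "l = r * sin (pi / real p)"

lemma a_pos: "a > 0"
  using p_ge_3 r_pos unfolding a_def by (intro mult_pos_pos cos_gt_zero) (auto simp: field_simps)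

lemma l_pos: "l > 0"
  using p_ge_3 r_pos unfolding l_def by (intro mult_pos_pos sin_gt_zero) (auto simp: field_simps)

lemma center_in: "z \<in> Q"
proof -
  let ?E = "{v. v extreme_point_of Q}"
  have fin: "finite ?E"
    using finite_polyhedron_extreme_points polytope polytope_imp_polyhedron by blast
  have "Q \<noteq> {}"
    using aff_dim by auto
  then have ne: "?E \<noteq> {}"
    using Krein_Milman_Minkowski[OF polytope_imp_compact[OF polytope] convex] by force
  have "(\<Sum>v\<in>?E. (1 / real (card ?E)) *\<^sub>R v) \<in> Q"
    using fin ne by (intro convex_sum[OF fin convex]) (auto simp: extreme_point_of_def)
  moreover have "z = (\<Sum>v\<in>?E. (1 / real (card ?E)) *\<^sub>R v)"
    using circumscribed
    by (simp add: circumscribed_about_def polytope_center_def divide_inverse flip: scaleR_sum_right)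
  ultimately show ?thesis
    by simp
qed

text \<open>
The vector \<open>n\<close> leads from the centre of the sphere to the centre of a facet, \<open>b\<close> points from there to the
midpoint of an edge and \<open>d\<close> is parallel to that edge. Each facet has \<open>2 p\<close> such frames.
\<close>
definition facet_frame where
  "facet_frame n b d \<longleftrightarrow> orthonormal_frame n b d \<and>
     convex hull (polygon_vertices p r (z + n) b d) facet_of Q"

lemma facet_frame_orthonormal: "facet_frame n b d \<Longrightarrow> orthonormal_frame n b d"
  by (simp add: facet_frame_def)

lemma edge_endpoints:
  "z + n + a *\<^sub>R b + l *\<^sub>R d \<in> polygon_vertices p r (z + n) b d" (is "?v \<in> _")
  "z + n + a *\<^sub>R b - l *\<^sub>R d \<in> polygon_vertices p r (z + n) b d" (is "?w \<in> _")
proof -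
  have "?v = z + n + r *\<^sub>R ray b d ((2 * of_int 0 + 1) * pi / real p)"
    by (simp add: a_def l_def ray_def algebra_simps)
  then show "?v \<in> polygon_vertices p r (z + n) b d"
    unfolding polygon_vertices_def by blast
  have "?w = z + n + r *\<^sub>R ray b d ((2 * of_int (- 1) + 1) * pi / real p)"
    by (simp add: a_def l_def ray_def algebra_simps)
  then show "?w \<in> polygon_vertices p r (z + n) b d"
    unfolding polygon_vertices_def by blast
qed

text \<open>
The plane of a facet meets the sphere only in the centre of the facet, so it is tangent there and the centre
gives its normal. The solid lies on the side of this plane that contains the centre of the sphere, because
that point is the centroid of the vertices.
\<close>
lemma facet_tangent_frame:
  assumes f: "f facet_of Q"
  defines "n \<equiv> polytope_center f - z"
  obtains b d where "facet_frame n b d" "f = convex hull polygon_vertices p r (z + n) b d"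
    "f = {x \<in> Q. n \<bullet> (x - z) = 1}" "\<And>x. x \<in> Q \<Longrightarrow> n \<bullet> (x - z) \<le> 1"
proof -
  obtain b d where bd: "norm b = 1" "norm d = 1" "b \<bullet> d = 0"
    and f_eq: "f = convex hull polygon_vertices p r (z + n) b d"
    using regular_polygonE[OF polygon[OF f]] unfolding n_def add_diff_cancel_left'
    by (metis add.commute diff_add_cancel)
  let ?c = "z + n" and ?v = "z + n + a *\<^sub>R b + l *\<^sub>R d" and ?w = "z + n + a *\<^sub>R b - l *\<^sub>R d"
  have bb: "b \<bullet> b = 1" "d \<bullet> d = 1" "d \<bullet> b = 0"
    using bd by (simp_all add: inner_commute norm_eq_1)
  have "affine hull f \<inter> sphere z 1 = {polytope_center f}"
    using circumscribed f unfolding circumscribed_about_def by blast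
  then have touch: "affine hull f \<inter> sphere z 1 = {?c}"
    by (simp add: n_def)
  then have c: "?c \<in> affine hull f" and "?c \<in> sphere z 1"
    by blast+
  then have n1: "norm n = 1"
    by (simp add: dist_norm)
  have nn: "n \<bullet> n = 1"
    using n1 by (simp add: norm_eq_1)
  have vw: "?v \<in> f" "?w \<in> f"
    using edge_endpoints unfolding f_eq by (auto intro: hull_inc)
  then have vwa: "?v \<in> affine hull f" "?w \<in> affine hull f"
    by (auto intro: hull_inc)
  have aff: "affine (affine hull f)"
    by simp
  have "?c + (t / (2 * l)) *\<^sub>R (?v - ?w) \<in> affine hull f" for t
    by (rule mem_affine_3_minus[OF aff c vwa])
  moreover have "?c + (t / (2 * l)) *\<^sub>R (?v - ?w) = ?c + t *\<^sub>R d" for t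
    using l_pos by (simp add: algebra_simps flip: scaleR_2 scaleR_add_left)
  ultimately have dline: "?c + t *\<^sub>R d \<in> affine hull f" for t
    by simp
  have "(?c + (t / (2 * a)) *\<^sub>R (?v - ?c)) + (t / (2 * a)) *\<^sub>R (?w - ?c) \<in> affine hull f" for t
    by (intro mem_affine_3_minus[OF aff] c vwa)
  moreover have "(?c + (t / (2 * a)) *\<^sub>R (?v - ?c)) + (t / (2 * a)) *\<^sub>R (?w - ?c) = ?c + t *\<^sub>R b" for t
    using a_pos by (simp add: algebra_simps flip: scaleR_2 scaleR_add_left)
  ultimately have bline: "?c + t *\<^sub>R b \<in> affine hull f" for t
    by metis
  have tangent: "n \<bullet> e = 0" if "e \<bullet> e = 1" "\<And>t. ?c + t *\<^sub>R e \<in> affine hull f" for e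
  proof -
    \<comment> \<open>the line through the point of contact in direction \<open>e\<close> meets the sphere again at this parameter\<close>
    let ?t = "- 2 * (n \<bullet> e)"
    have "(n + ?t *\<^sub>R e) \<bullet> (n + ?t *\<^sub>R e) = 1"
      using that(1) nn by (simp add: inner_simps inner_commute power2_eq_square algebra_simps)
    then have "norm (n + ?t *\<^sub>R e) = 1"
      by (simp only: norm_eq_1)
    moreover have "?c + ?t *\<^sub>R e - z = n + ?t *\<^sub>R e"
      by simp
    ultimately have "?c + ?t *\<^sub>R e \<in> sphere z 1"
      by (simp only: mem_sphere dist_norm norm_minus_commute[of z])
    then have "?c + ?t *\<^sub>R e = ?c"
      using that(2)[of ?t] touch by blast
    then show ?thesis
      using that(1) by auto
  qed
  have nb: "n \<bullet> b = 0" and nd: "n \<bullet> d = 0"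
    using tangent bb bline dline by auto
  have fr: "orthonormal_frame n b d"
    using nn bb bd nb nd by (simp add: orthonormal_frame_def)
  obtain e \<beta> where e: "e \<noteq> 0" "Q \<subseteq> {x. e \<bullet> x \<le> \<beta>}" "f = Q \<inter> {x. e \<bullet> x = \<beta>}"
    using facet_of_polyhedron[OF polytope_imp_polyhedron[OF polytope] f] by auto
  have "affine hull f \<subseteq> {x. e \<bullet> x = \<beta>}"
    by (rule hull_minimal) (use e affine_hyperplane in auto)
  then have ec: "e \<bullet> ?c = \<beta>" "e \<bullet> (?c + 1 *\<^sub>R b) = \<beta>" "e \<bullet> (?c + 1 *\<^sub>R d) = \<beta>"
    using c bline[of 1] dline[of 1] by auto
  then have "e \<bullet> b = 0" "e \<bullet> d = 0"
    by (simp_all add: inner_add_right)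
  then have e_eq: "e = (e \<bullet> n) *\<^sub>R n"
    using orthonormal_frame_expand[OF fr, of e] by simp
  define k where "k = e \<bullet> n"
  have \<beta>: "\<beta> = e \<bullet> z + k"
    using ec by (simp add: k_def inner_add_right)
  have "k \<ge> 0"
    using center_in e(2) \<beta> by auto
  moreover have "k \<noteq> 0"
    using e_eq e(1) by (auto simp: k_def)
  ultimately have k: "k > 0"
    by simp
  have ex: "e \<bullet> x = e \<bullet> z + k * (n \<bullet> (x - z))" for x
  proof -
    have "e \<bullet> (x - z) = k * (n \<bullet> (x - z))"
      using e_eq by (metis inner_scaleR_left k_def)
    then show ?thesis
      by (simp add: inner_diff_right)
  qed
  have le: "e \<bullet> x \<le> \<beta> \<longleftrightarrow> n \<bullet> (x - z) \<le> 1" and eq: "e \<bullet> x = \<beta> \<longleftrightarrow> n \<bullet> (x - z) = 1" for x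
    unfolding \<beta> using ex[of x] k by auto
  have "n \<bullet> (x - z) \<le> 1" if "x \<in> Q" for x
    using that e(2) le by blast
  moreover have "f = {x \<in> Q. n \<bullet> (x - z) = 1}"
    using e(3) eq by blast
  moreover have "facet_frame n b d"
    using fr f f_eq by (simp add: facet_frame_def)
  ultimately show thesis
    using that f_eq by blast
qed


lemma facet_frame_supporting:
  assumes "facet_frame n b d"
  shows "x \<in> Q \<Longrightarrow> n \<bullet> (x - z) \<le> 1"
    and "convex hull polygon_vertices p r (z + n) b d = {x \<in> Q. n \<bullet> (x - z) = 1}"
proof -
  have f: "convex hull polygon_vertices p r (z + n) b d facet_of Q"
    and o: "orthonormal_frame n b d"
    using assms by (auto simp: facet_frame_def)
  have "polytope_center (convex hull polygon_vertices p r (z + n) b d) - z = n"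
    using polytope_center_polygon[of p r b d "z + n"] p_ge_3 r_pos orthonormal_frameD[OF o] by simp
  then show "x \<in> Q \<Longrightarrow> n \<bullet> (x - z) \<le> 1"
    "convex hull polygon_vertices p r (z + n) b d = {x \<in> Q. n \<bullet> (x - z) = 1}"
    using facet_tangent_frame[OF f] by metis+
qed

lemma facet_frame_rotate:
  assumes "facet_frame n b d"
  shows "facet_frame n (ray b d (2 * pi * of_int k / real p)) (ray b d (2 * pi * of_int k / real p + pi / 2))"
  using assms polygon_vertices_rotate[of p r "z + n" b d k] p_ge_3
  by (simp add: facet_frame_def orthonormal_frame_rotate)

lemma facet_frame_reflect: "facet_frame n b d \<Longrightarrow> facet_frame n b (- d)"
  by (simp add: facet_frame_def polygon_vertices_reflect orthonormal_frame_def)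

text \<open>
These two numbers describe the rotation that moves each edge of a facet to the next one. Composed with the
reversal of the edge it becomes the reflection that exchanges the two edges at the vertex
\<open>n + a b + l d\<close> of the facet, whence the fixed point equations of \<open>vertex_reflect_rotation\<close>.
\<close>
definition C where "C = cos (2 * pi / real p)"
definition S where "S = sin (2 * pi / real p)"

lemma facet_frame_vertex_reflect:
  assumes "facet_frame n b d"
  shows "facet_frame n (C *\<^sub>R b + S *\<^sub>R d) (S *\<^sub>R b - C *\<^sub>R d)"
proof -
  have "ray b d (2 * pi * of_int 1 / real p) = C *\<^sub>R b + S *\<^sub>R d"
    "- ray b d (2 * pi * of_int 1 / real p + pi / 2) = S *\<^sub>R b - C *\<^sub>R d"
    by (simp_all add: ray_def C_def S_def cos_add sin_add)
  then show ?thesis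
    using facet_frame_reflect[OF facet_frame_rotate[OF assms, of 1]] by metis
qed

lemma vertex_reflect_rotation: "a * C + l * S = a" "a * S - l * C = l"
proof -
  have "2 * pi / real p = pi / real p + pi / real p"
    by simp
  then have *: "cos (2 * pi / real p - pi / real p) = cos (pi / real p)"
    "sin (2 * pi / real p - pi / real p) = sin (pi / real p)"
    by simp_all
  have "a * C + l * S = r * cos (2 * pi / real p - pi / real p)"
    unfolding cos_diff by (simp add: a_def l_def C_def S_def algebra_simps)
  then show "a * C + l * S = a"
    by (simp only: * a_def)
  have "a * S - l * C = r * sin (2 * pi / real p - pi / real p)"
    unfolding sin_diff by (simp add: a_def l_def C_def S_def algebra_simps)
  then show "a * S - l * C = l"
    by (simp only: * l_def)
qed

section \<open>Crossing an edge\<close>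

lemma edge_endpoints_ray:
  "a *\<^sub>R b + l *\<^sub>R d = r *\<^sub>R ray b d (pi / real p)" "a *\<^sub>R b - l *\<^sub>R d = r *\<^sub>R ray b d (- pi / real p)"
  by (simp_all add: a_def l_def ray_def algebra_simps)

lemma edge_face_of:
  assumes "facet_frame n b d"
  shows "convex hull {z + n + a *\<^sub>R b + l *\<^sub>R d, z + n + a *\<^sub>R b - l *\<^sub>R d} face_of Q" (is "?e face_of Q")
proof -
  let ?V = "polygon_vertices p r (z + n) b d"
  let ?v = "z + n + a *\<^sub>R b + l *\<^sub>R d" and ?w = "z + n + a *\<^sub>R b - l *\<^sub>R d"
  note o = orthonormal_frameD[OF facet_frame_orthonormal[OF assms]]
  have "b \<bullet> ?v = b \<bullet> (z + n) + a" "b \<bullet> ?w = b \<bullet> (z + n) + a"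
    using o by (simp_all add: inner_simps)
  then have 1: "affine hull {?v, ?w} \<subseteq> {x. b \<bullet> x = b \<bullet> (z + n) + a}"
    by (intro hull_minimal) (auto simp: affine_hyperplane)
  have "?V - {?v, ?w} \<subseteq> {x. b \<bullet> x < b \<bullet> (z + n) + a}"
  proof
    fix y assume y: "y \<in> ?V - {?v, ?w}"
    then obtain i :: int where i: "y = z + n + r *\<^sub>R ray b d ((2 * of_int i + 1) * pi / real p)"
      by (auto simp: polygon_vertices_def)
    have "ray b d ((2 * of_int i + 1) * pi / real p) \<noteq> ray b d (pi / real p)"
      "ray b d ((2 * of_int i + 1) * pi / real p) \<noteq> ray b d (- pi / real p)"
      using y edge_endpoints_ray[of b d] by (auto simp: i algebra_simps)
    then have "ray b d ((2 * of_int i + 1) * pi / real p) \<bullet> b < cos (pi / real p)"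
      using polygon_edge_index[OF p_ge_3 o(11,12,6), of i] by blast
    then have "r * (ray b d ((2 * of_int i + 1) * pi / real p) \<bullet> b) < a"
      using r_pos by (simp add: a_def)
    then show "y \<in> {x. b \<bullet> x < b \<bullet> (z + n) + a}"
      by (simp add: i inner_add_right inner_commute)
  qed
  then have 2: "convex hull (?V - {?v, ?w}) \<subseteq> {x. b \<bullet> x < b \<bullet> (z + n) + a}"
    by (intro hull_minimal) (auto simp: convex_halfspace_lt)
  have "?e face_of (convex hull ?V)"
    using 1 2 edge_endpoints p_ge_3
    by (intro face_of_convex_hulls finite_polygon_vertices) fastforce+
  moreover have "convex hull ?V face_of Q"
    using assms by (simp add: facet_frame_def facet_of_imp_face_of)
  ultimately show ?thesis
    by (rule face_of_trans)
qed

text \<open>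
The vertices of the solid in the plane of a facet are the vertices of that facet. This makes the
endpoints of an edge of one facet recognisable in another facet that contains the edge.
\<close>
lemma facet_frame_extreme_points:
  assumes "facet_frame n b d"
  shows "v \<in> polygon_vertices p r (z + n) b d \<longleftrightarrow> v extreme_point_of Q \<and> n \<bullet> (v - z) = 1"
proof -
  let ?V = "polygon_vertices p r (z + n) b d"
  note o = orthonormal_frameD[OF facet_frame_orthonormal[OF assms]]
  have "{x. x extreme_point_of (convex hull ?V)} = ?V"
    by (rule extreme_points_hull_of_sphere_subset[OF polygon_vertices_sphere[OF o(11,12,6)]])
      (use r_pos in simp)
  then have "v \<in> ?V \<longleftrightarrow> v extreme_point_of (convex hull ?V)"
    by blast
  also have "\<dots> \<longleftrightarrow> v extreme_point_of Q \<and> v \<in> convex hull ?V"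
    using assms by (intro extreme_point_of_face) (simp add: facet_frame_def facet_of_imp_face_of)
  also have "\<dots> \<longleftrightarrow> v extreme_point_of Q \<and> n \<bullet> (v - z) = 1"
    unfolding facet_frame_supporting(2)[OF assms] by (auto simp: extreme_point_of_def)
  finally show ?thesis .
qed

text \<open>
An edge is a proper face, hence the intersection of the facets that contain it; it is not a facet, so there
are at least two of them. In the second facet the edge joins two vertices at the distance of adjacent ones,
and congruence of the facets makes it an edge there as well. A suitable frame of the second facet has this
edge as its own, with the same midpoint and direction.
\<close>
lemma edge_in_second_facet:
  assumes fr: "facet_frame n b d"
  obtains n' b' d' where "facet_frame n' b' d'" "n' \<noteq> n"
    "n' + a *\<^sub>R b' = n + a *\<^sub>R b" "d' = d"
proof -
  let ?V = "\<lambda>n b d. polygon_vertices p r (z + n) b d"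
  let ?f = "convex hull (?V n b d)"
  let ?v = "z + n + a *\<^sub>R b + l *\<^sub>R d" and ?w = "z + n + a *\<^sub>R b - l *\<^sub>R d"
  let ?e = "convex hull {?v, ?w}"
  note o = orthonormal_frameD[OF facet_frame_orthonormal[OF fr]]
  have f: "?f facet_of Q"
    using fr by (simp add: facet_frame_def)
  have sub: "?e \<subseteq> ?f"
    by (intro hull_mono) (use edge_endpoints in auto)
  have "aff_dim ?e \<le> 1"
    by (simp add: aff_dim_convex_hull)
  then have ne: "?e \<noteq> ?f" "?e \<noteq> Q"
    using f aff_dim unfolding facet_of_def by force+
  have "?e = \<Inter>{h. h facet_of Q \<and> ?e \<subseteq> h}"
    using edge_face_of[OF fr] ne polytope_imp_polyhedron[OF polytope]
    by (intro face_of_polyhedron) auto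
  then have "{h. h facet_of Q \<and> ?e \<subseteq> h} \<noteq> {?f}"
    using ne by auto
  then obtain g where g: "g facet_of Q" "?e \<subseteq> g" "g \<noteq> ?f"
    using f sub by blast
  define n' where "n' = polytope_center g - z"
  obtain b' d' where fr': "facet_frame n' b' d'" and g_eq: "g = convex hull ?V n' b' d'"
    using facet_tangent_frame[OF g(1)] unfolding n'_def by metis
  note o' = orthonormal_frameD[OF facet_frame_orthonormal[OF fr']]
  have n': "n' \<noteq> n"
    using facet_frame_supporting(2)[OF fr] facet_frame_supporting(2)[OF fr'] g(3) g_eq by auto
  have "?v \<in> g" "?w \<in> g"
    using g(2) by (auto intro: hull_inc)
  then have "n' \<bullet> (?v - z) = 1" "n' \<bullet> (?w - z) = 1"
    using facet_frame_supporting(2)[OF fr'] g_eq by auto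
  then have vw: "?v \<in> ?V n' b' d'" "?w \<in> ?V n' b' d'"
    using facet_frame_extreme_points[OF fr'] facet_frame_extreme_points[OF fr] edge_endpoints[of n b d]
    by blast+
  then obtain i j :: int where i: "?v = z + n' + r *\<^sub>R ray b' d' ((2 * of_int i + 1) * pi / real p)"
    and j: "?w = z + n' + r *\<^sub>R ray b' d' ((2 * of_int j + 1) * pi / real p)"
    unfolding polygon_vertices_def by (elim rangeE)
  \<comment> \<open>turn the frame of the second facet so that the first endpoint gets index 0; the second one then
    has index 1 or -1\<close>
  define b1 where "b1 = ray b' d' (2 * pi * of_int i / real p)"
  define d1 where "d1 = ray b' d' (2 * pi * of_int i / real p + pi / 2)"
  have fr1: "facet_frame n' b1 d1"
    unfolding b1_def d1_def by (rule facet_frame_rotate[OF fr'])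
  note o1 = orthonormal_frameD[OF facet_frame_orthonormal[OF fr1]]
  define \<phi> where "\<phi> = 2 * pi * of_int (j - i) / real p"
  have "(2 * of_int i + 1) * pi / real p = 2 * pi * of_int i / real p + pi / real p"
    "(2 * of_int j + 1) * pi / real p = 2 * pi * of_int i / real p + (pi / real p + \<phi>)"
    using p_ge_3 by (simp_all add: field_simps \<phi>_def)
  then have v: "?v = z + n' + r *\<^sub>R ray b1 d1 (pi / real p)"
    and w: "?w = z + n' + r *\<^sub>R ray b1 d1 (pi / real p + \<phi>)"
    using i j by (simp_all only: b1_def d1_def ray_ray)
  have cos_eq: "cos \<phi> = cos (2 * pi / real p)"
  proof -
    have cs: "(cos t)\<^sup>2 + (sin t)\<^sup>2 = 1" for t :: real
      by simp
    have "?v - ?w = (2 * l) *\<^sub>R d"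
      by (simp add: scaleR_2 flip: scaleR_scaleR)
    then have "(?v - ?w) \<bullet> (?v - ?w) = 4 * l\<^sup>2"
      using o by (simp add: power2_eq_square)
    also have "4 * l\<^sup>2 = 2 * r\<^sup>2 * (1 - cos (2 * pi / real p))"
      using cos_double_sin[of "pi / real p"] by (simp add: l_def power_mult_distrib)
    finally have "(?v - ?w) \<bullet> (?v - ?w) = 2 * r\<^sup>2 * (1 - cos (2 * pi / real p))" .
    moreover have "(?v - ?w) \<bullet> (?v - ?w) = 2 * r\<^sup>2 * (1 - cos \<phi>)"
    proof -
      let ?x = "ray b1 d1 (pi / real p)" and ?y = "ray b1 d1 (pi / real p + \<phi>)"
      have "?x \<bullet> ?y = cos (pi / real p) * cos (pi / real p + \<phi>) + sin (pi / real p) * sin (pi / real p + \<phi>)"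
        using o1 by (simp add: ray_def inner_simps)
      also have "\<dots> = cos ((pi / real p + \<phi>) - pi / real p)"
        by (simp only: cos_diff mult.commute)
      finally have xy: "?x \<bullet> ?y = cos \<phi>"
        by simp
      have xx: "?x \<bullet> ?x = 1" "?y \<bullet> ?y = 1"
        using norm_ray[OF o1(11,12,6)] by (simp_all add: norm_eq_1)
      have "?v - ?w = r *\<^sub>R (?x - ?y)"
        unfolding v w by (simp add: scaleR_diff_right)
      then have "(?v - ?w) \<bullet> (?v - ?w) = r * (r * ((?x - ?y) \<bullet> (?x - ?y)))"
        by (simp only: inner_scaleR_left inner_scaleR_right)
      also have "(?x - ?y) \<bullet> (?x - ?y) = 2 * (1 - cos \<phi>)"
        using xx xy by (simp add: inner_diff_left inner_diff_right inner_commute)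
      finally show ?thesis
        by (simp add: power2_eq_square)
    qed
    ultimately show ?thesis
      using r_pos by simp
  qed
  have "(sin \<phi>)\<^sup>2 = (sin (2 * pi / real p))\<^sup>2"
    using cos_eq by (simp add: sin_squared_eq)
  then consider "sin \<phi> = - sin (2 * pi / real p)" | "sin \<phi> = sin (2 * pi / real p)"
    by (auto simp: power2_eq_iff)
  then obtain b2 d2 where fr2: "facet_frame n' b2 d2"
    and v2: "?v = z + n' + (a *\<^sub>R b2 + l *\<^sub>R d2)" and w2: "?w = z + n' + (a *\<^sub>R b2 - l *\<^sub>R d2)"
  proof cases
    case 1
    have "ray b1 d1 (pi / real p + \<phi>) = ray b1 d1 (pi / real p + - (2 * pi / real p))"
      unfolding cos_eq 1 ray_def cos_add sin_add by simp
    also have "pi / real p + - (2 * pi / real p) = - pi / real p"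
      by simp
    finally show thesis
      using that[OF fr1] v w by (simp only: edge_endpoints_ray)
  next
    case 2
    have *: "ray b1 d1 (pi / real p + \<phi>) = ray b1 d1 (pi / real p + 2 * pi / real p)"
      unfolding cos_eq 2 ray_def cos_add sin_add by simp
    let ?b = "ray b1 d1 (2 * pi * of_int 1 / real p)"
    let ?d = "- ray b1 d1 (2 * pi * of_int 1 / real p + pi / 2)"
    have fr2: "facet_frame n' ?b ?d"
      by (rule facet_frame_reflect[OF facet_frame_rotate[OF fr1]])
    have r: "ray ?b ?d \<psi> = ray b1 d1 (2 * pi / real p - \<psi>)" for \<psi>
      unfolding ray_reflect ray_ray by simp
    have "2 * pi / real p - pi / real p = pi / real p" "2 * pi / real p - - pi / real p = pi / real p + 2 * pi / real p"
      by simp_all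
    then show thesis
      using that[OF fr2] v w * by (simp only: edge_endpoints_ray r)
  qed
  have "2 *\<^sub>R (n + a *\<^sub>R b) = (?v - z) + (?w - z)"
    by (simp add: scaleR_2)
  also have "\<dots> = 2 *\<^sub>R (n' + a *\<^sub>R b2)"
    unfolding v2 w2 by (simp add: scaleR_2)
  finally have "n' + a *\<^sub>R b2 = n + a *\<^sub>R b"
    by simp
  have "(2 * l) *\<^sub>R d = ?v - ?w"
    by (simp add: scaleR_2 flip: scaleR_scaleR)
  also have "\<dots> = (2 * l) *\<^sub>R d2"
    unfolding v2 w2 by (simp add: scaleR_2 flip: scaleR_scaleR)
  finally have "d2 = d"
    using l_pos by simp
  then show thesis
    using that[OF fr2 n'] \<open>n' + a *\<^sub>R b2 = n + a *\<^sub>R b\<close> by blast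
qed

text \<open>
The reflection across the plane through the origin and an edge fixes the midpoint \<open>n + a b\<close> of the edge. In
the basis \<open>n\<close>, \<open>b\<close> its matrix has the entries \<open>s\<close> and \<open>c\<close>; in particular \<open>s\<close> is the inner product of
the normals of adjacent facets.
\<close>
definition s where "s = (1 - a\<^sup>2) / (1 + a\<^sup>2)"
definition c where "c = 2 * a / (1 + a\<^sup>2)"

lemma flip_rotation: "s + c * a = 1" "c - s * a = a" "s\<^sup>2 + c\<^sup>2 = 1" "c > 0" "c * a = 1 - s"
proof -
  have pos: "1 + a\<^sup>2 > 0"
    by (simp add: add_pos_nonneg)
  then have sA: "s * (1 + a\<^sup>2) = 1 - a\<^sup>2" and cA: "c * (1 + a\<^sup>2) = 2 * a"
    by (simp_all add: s_def c_def)
  show "c > 0"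
    using pos a_pos by (simp add: c_def)
  have cancel: "u = v" if "u * (1 + a\<^sup>2) = v * (1 + a\<^sup>2)" for u v
    using that pos by simp
  show 1: "s + c * a = 1"
    by (rule cancel) (use sA cA in algebra)
  show "c - s * a = a"
    by (rule cancel) (use sA cA in algebra)
  show "s\<^sup>2 + c\<^sup>2 = 1"
    by (rule cancel, rule cancel) (use sA cA in algebra)
  show "c * a = 1 - s"
    using 1 by simp
qed

text \<open>
The adjacent frame shares the midpoint \<open>n + a b\<close> and the direction \<open>d\<close>. Its normal lies in the plane of \<open>n\<close>
and \<open>b\<close>, where the unit circle has just two points whose inner product with \<open>n + a b\<close> is 1: the
normal \<open>n\<close> itself and its mirror image.
\<close>
lemma facet_frame_flip:
  assumes fr: "facet_frame n b d"
  shows "facet_frame (s *\<^sub>R n + c *\<^sub>R b) (c *\<^sub>R n - s *\<^sub>R b) d"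
proof -
  obtain n' b' d' where fr': "facet_frame n' b' d'" and ne: "n' \<noteq> n"
    and m: "n' + a *\<^sub>R b' = n + a *\<^sub>R b" and "d' = d"
    using edge_in_second_facet[OF fr] .
  then have fr': "facet_frame n' b' d"
    by simp
  note O = facet_frame_orthonormal[OF fr] and O' = facet_frame_orthonormal[OF fr']
  note o = orthonormal_frameD[OF O] and o' = orthonormal_frameD[OF O']
  define x y where "x = n' \<bullet> n" and "y = n' \<bullet> b"
  have n': "n' = x *\<^sub>R n + y *\<^sub>R b"
    using orthonormal_frame_expand[OF O, of n'] o' by (simp add: x_def y_def)
  have 1: "x\<^sup>2 + y\<^sup>2 = 1"
    using orthonormal_frame_inner[OF O, of n' n'] o' by (simp add: x_def y_def power2_eq_square)
  have "n' \<bullet> (n' + a *\<^sub>R b') = 1"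
    using o' by (simp add: inner_simps)
  then have 2: "x + a * y = 1"
    unfolding m by (simp add: x_def y_def inner_simps)
  have "y \<noteq> 0"
    using ne n' 2 by auto
  have "(1 - a * y)\<^sup>2 + y\<^sup>2 = 1"
    using 1 2 by (metis add_diff_cancel_right')
  then have "y * ((1 + a\<^sup>2) * y - 2 * a) = 0"
    by (simp add: power2_eq_square algebra_simps)
  moreover have pos: "1 + a\<^sup>2 > 0"
    by (simp add: add_pos_nonneg)
  ultimately have "(1 + a\<^sup>2) * y = 2 * a"
    using \<open>y \<noteq> 0\<close> by (metis eq_iff_diff_eq_0 mult_eq_0_iff)
  then have y: "y = c"
    using pos by (simp add: c_def eq_divide_eq mult.commute)
  then have x: "x = s"
    using 2 flip_rotation(5) by (simp add: algebra_simps)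
  have n'_eq: "n' = s *\<^sub>R n + c *\<^sub>R b"
    using n' x y by simp
  have "a *\<^sub>R b' = (1 - s) *\<^sub>R n + (a - c) *\<^sub>R b"
    using m unfolding n'_eq by (simp add: algebra_simps)
  also have "1 - s = a * c"
    using flip_rotation(5) by (simp add: mult.commute)
  also have "a - c = - (a * s)"
    using flip_rotation(2) by (simp add: mult.commute)
  also have "(a * c) *\<^sub>R n + (- (a * s)) *\<^sub>R b = a *\<^sub>R (c *\<^sub>R n - s *\<^sub>R b)"
    by (simp add: scaleR_diff_right)
  finally have "b' = c *\<^sub>R n - s *\<^sub>R b"
    using a_pos by simp
  then show ?thesis
    using fr' n'_eq by simp
qed

end

section \<open>The facets at a vertex\<close>

text \<open>The cosines of the multiples of \<open>\<theta>\<close> satisfy the same recurrence.\<close>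
lemma cos_recurrence_inner:
  fixes x :: "nat \<Rightarrow> 'a::real_inner"
  assumes step: "\<And>i. x (Suc (Suc i)) = (2 * cos \<theta>) *\<^sub>R x (Suc i) - x i"
    and norm: "\<And>i. x i \<bullet> x i = \<rho>" and consecutive: "\<And>i. x i \<bullet> x (Suc i) = \<rho> * cos \<theta>"
  shows "x i \<bullet> x (i + k) = \<rho> * cos (real k * \<theta>)"
proof (induction k rule: less_induct)
  case (less k)
  consider "k = 0" | "k = 1" | j where "k = Suc (Suc j)"
    by (metis One_nat_def not0_implies_Suc)
  then show ?case
  proof cases
    case 3
    have "x i \<bullet> x (i + k) = 2 * cos \<theta> * (x i \<bullet> x (i + Suc j)) - x i \<bullet> x (i + j)"
      by (simp add: 3 step inner_diff_right)
    also have "\<dots> = \<rho> * (2 * cos \<theta> * cos (real (Suc j) * \<theta>) - cos (real j * \<theta>))"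
      using less[of j] less[of "Suc j"] 3 by (simp add: algebra_simps)
    also have "2 * cos \<theta> * cos (real (Suc j) * \<theta>) - cos (real j * \<theta>) = cos (real k * \<theta>)"
    proof -
      have "real k * \<theta> = real (Suc j) * \<theta> + \<theta>" "real j * \<theta> = real (Suc j) * \<theta> - \<theta>"
        by (simp_all add: 3 algebra_simps)
      then show ?thesis
        by (simp only: cos_add cos_diff) simp
    qed
    finally show ?thesis .
  qed (use norm consecutive in simp_all)
qed

text \<open>
Two members of the sequence coincide exactly if the angle between them is a multiple of the full turn. So a
finite range means periodicity, and the number of values is the least period.
\<close>
lemma cos_recurrence_finite_range:
  fixes x :: "nat \<Rightarrow> 'a::real_inner"
  assumes step: "\<And>i. x (Suc (Suc i)) = (2 * cos \<theta>) *\<^sub>R x (Suc i) - x i"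
    and norm: "\<And>i. x i \<bullet> x i = \<rho>" and consecutive: "\<And>i. x i \<bullet> x (Suc i) = \<rho> * cos \<theta>"
    and \<rho>: "\<rho> > 0" and fin: "finite (range x)"
  shows "cos (real (card (range x)) * \<theta>) = 1"
    and "\<And>i. 0 < i \<Longrightarrow> i < card (range x) \<Longrightarrow> cos (real i * \<theta>) \<noteq> 1"
    and "\<And>i. x (i + card (range x)) = x i" and "card (range x) > 0"
proof -
  note inner = cos_recurrence_inner[of x, OF step norm consecutive]
  have eq_iff: "x (i + k) = x i \<longleftrightarrow> cos (real k * \<theta>) = 1" for i k
  proof -
    have "(x (i + k) - x i) \<bullet> (x (i + k) - x i) = 2 * \<rho> * (1 - cos (real k * \<theta>))"
      using inner[of i k] norm by (simp add: inner_diff_left inner_diff_right inner_commute algebra_simps)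
    then show ?thesis
      using \<rho> by (metis diff_0_right eq_iff_diff_eq_0 inner_eq_zero_iff less_irrefl mult_eq_0_iff
          zero_neq_numeral)
  qed
  define P where "P = (\<lambda>k. k > 0 \<and> cos (real k * \<theta>) = 1)"
  have "\<not> inj x"
    using fin finite_imageD[of x UNIV] by auto
  then obtain i j where "i < j" "x i = x j"
    by (metis injI linorder_neqE_nat)
  then have "P (j - i)"
    using eq_iff[of i "j - i"] by (simp add: P_def)
  define m where "m = (LEAST k. P k)"
  have Pm: "P m"
    unfolding m_def by (rule LeastI) fact
  have least: "\<not> P k" if "k < m" for k
    using that not_less_Least unfolding m_def by blast
  have per: "x (i + m) = x i" for i
    using Pm eq_iff by (simp add: P_def)
  have "x (i mod m) = x i" for i
  proof -
    have "x (i mod m + k * m) = x (i mod m)" for k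
      by (induction k) (use per in \<open>simp_all add: add.assoc[symmetric] add.commute[of m]\<close>)
    then show ?thesis
      by (metis mod_div_mult_eq)
  qed
  then have "range x = x ` {..<m}"
    using Pm by (auto simp: P_def image_iff) (metis mod_less_divisor lessThan_iff)
  moreover have "inj_on x {..<m}"
  proof (rule linorder_inj_onI)
    fix i j assume "i < j" "i \<in> {..<m}" "j \<in> {..<m}"
    then show "x i \<noteq> x j"
      using eq_iff[of i "j - i"] least[of "j - i"] by (auto simp: P_def)
  qed auto
  ultimately have card: "card (range x) = m"
    by (simp add: card_image)
  show "cos (real (card (range x)) * \<theta>) = 1" "card (range x) > 0"
    using Pm by (simp_all add: card P_def)
  show "\<And>i. x (i + card (range x)) = x i"
    using per by (simp add: card)
  show "\<And>i. 0 < i \<Longrightarrow> i < card (range x) \<Longrightarrow> cos (real i * \<theta>) \<noteq> 1"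
    using least by (auto simp: card P_def)
qed

text \<open>
Up to a constant factor \<open>cos (q \<theta>) - 1\<close> is \<open>(u - 1) (2 u + 1)^2\<close>, \<open>u^2 (u^2 - 1)\<close> and \<open>(u - 1) (4 u^2 + 2 u - 1)^2\<close>
as a polynomial in \<open>u = cos \<theta>\<close>, for \<open>q = 3, 4, 5\<close>. Primitivity removes the factors that belong to
smaller \<open>q\<close>.
\<close>
lemma cos_primitive_root:
  assumes one: "cos (real q * \<theta>) = 1" and ne: "\<And>i. 0 < i \<Longrightarrow> i < q \<Longrightarrow> cos (real i * \<theta>) \<noteq> 1"
  shows "q = 3 \<Longrightarrow> 2 * cos \<theta> = -1" "q = 4 \<Longrightarrow> 2 * cos \<theta> = 0"
    "q = 5 \<Longrightarrow> (2 * cos \<theta>)\<^sup>2 + 2 * cos \<theta> = 1"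
proof -
  define u where "u = cos \<theta>"
  have c2: "cos (2 * t) = 2 * (cos t)\<^sup>2 - 1" for t :: real
    by (rule cos_double_cos)
  have c3: "cos (3 * t) = 4 * cos t ^ 3 - 3 * cos t" for t :: real
    by (rule cos_treble_cos)
  show "2 * cos \<theta> = -1" if q: "q = 3"
  proof -
    have "(u - 1) * (2 * u + 1)\<^sup>2 = 4 * u ^ 3 - 3 * u - 1"
      by algebra
    also have "\<dots> = 0"
      using one by (simp add: q c3 u_def)
    finally have "(u - 1) * (2 * u + 1)\<^sup>2 = 0" .
    then show ?thesis
      using ne[of 1] q by (auto simp: u_def)
  qed
  show "2 * cos \<theta> = 0" if q: "q = 4"
  proof -
    have "cos (4 * \<theta>) = 2 * (2 * u\<^sup>2 - 1)\<^sup>2 - 1"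
      using c2[of "2 * \<theta>"] c2[of \<theta>] by (simp add: u_def)
    then have "u\<^sup>2 * (u\<^sup>2 - 1) = 0"
      using one by (simp add: q power2_eq_square algebra_simps)
    moreover have "u\<^sup>2 \<noteq> 1"
      using ne[of 2] q c2[of \<theta>] by (simp add: u_def)
    ultimately show ?thesis
      by (simp add: u_def)
  qed
  show "(2 * cos \<theta>)\<^sup>2 + 2 * cos \<theta> = 1" if q: "q = 5"
  proof -
    have "cos (5 * \<theta>) = cos (3 * \<theta> + 2 * \<theta>)"
      by simp
    also have "\<dots> = 2 * cos (3 * \<theta>) * cos (2 * \<theta>) - cos (3 * \<theta> - 2 * \<theta>)"
      by (simp only: cos_add cos_diff)
    also have "\<dots> = 2 * (4 * u ^ 3 - 3 * u) * (2 * u\<^sup>2 - 1) - u"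
      by (simp add: c2 c3 u_def)
    finally have "(u - 1) * ((2 * u)\<^sup>2 + 2 * u - 1)\<^sup>2 = 0"
      using one unfolding q by simp algebra
    then show ?thesis
      using ne[of 1] q by (auto simp: u_def)
  qed
qed

context regular_solid
begin

definition is_normal where "is_normal n \<longleftrightarrow> (\<exists>b d. facet_frame n b d)"

lemma facet_normal:
  assumes "f facet_of Q"
  shows "is_normal (polytope_center f - z)"
    and "{x \<in> Q. (polytope_center f - z) \<bullet> (x - z) = 1} = f"
proof -
  obtain b d where "facet_frame (polytope_center f - z) b d"
    and eq: "f = {x \<in> Q. (polytope_center f - z) \<bullet> (x - z) = 1}"
    by (rule facet_tangent_frame[OF assms])
  then show "is_normal (polytope_center f - z)"
    unfolding is_normal_def by blast
  show "{x \<in> Q. (polytope_center f - z) \<bullet> (x - z) = 1} = f"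
    using eq by simp
qed

lemma normal_facet_bij:
  "bij_betw (\<lambda>f. polytope_center f - z) {f. f facet_of Q} (Collect is_normal)"
proof (rule bij_betw_byWitness[where f' = "\<lambda>n. {x \<in> Q. n \<bullet> (x - z) = 1}"])
  show "\<forall>f\<in>{f. f facet_of Q}. {x \<in> Q. (polytope_center f - z) \<bullet> (x - z) = 1} = f"
    using facet_normal(2) by simp
  show "\<forall>n\<in>Collect is_normal. polytope_center {x \<in> Q. n \<bullet> (x - z) = 1} - z = n"
  proof
    fix n assume "n \<in> Collect is_normal"
    then obtain b d where fr: "facet_frame n b d"
      by (auto simp: is_normal_def)
    note o = orthonormal_frameD[OF facet_frame_orthonormal[OF fr]]
    show "polytope_center {x \<in> Q. n \<bullet> (x - z) = 1} - z = n"
      using polytope_center_polygon[OF _ r_pos o(11,12,6), of p "z + n"] p_ge_3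
      by (simp add: facet_frame_supporting(2)[OF fr])
  qed
  show "(\<lambda>f. polytope_center f - z) ` {f. f facet_of Q} \<subseteq> Collect is_normal"
    using facet_normal(1) by auto
  show "(\<lambda>n. {x \<in> Q. n \<bullet> (x - z) = 1}) ` Collect is_normal \<subseteq> {f. f facet_of Q}"
  proof clarify
    fix n assume "is_normal n"
    then obtain b d where fr: "facet_frame n b d"
      by (auto simp: is_normal_def)
    then show "{x \<in> Q. n \<bullet> (x - z) = 1} facet_of Q"
      unfolding facet_frame_supporting(2)[OF fr, symmetric] by (simp add: facet_frame_def)
  qed
qed

lemma finite_normals: "finite (Collect is_normal)"
  using bij_betw_finite[OF normal_facet_bij] finite_polytope_facets[OF polytope] by blast

lemma normal_unit: "is_normal n \<Longrightarrow> n \<bullet> n = 1"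
  using facet_frame_orthonormal orthonormal_frameD(1) unfolding is_normal_def by blast

lemma normal_supporting: "is_normal n \<Longrightarrow> x \<in> Q \<Longrightarrow> n \<bullet> (x - z) \<le> 1"
  using facet_frame_supporting(1) unfolding is_normal_def by blast

lemma vertex_in:
  assumes "facet_frame n b d"
  shows "z + (n + a *\<^sub>R b + l *\<^sub>R d) \<in> Q" "z + (n + a *\<^sub>R b - l *\<^sub>R d) \<in> Q"
    "z + (n + a *\<^sub>R b + l *\<^sub>R d) extreme_point_of Q"
proof -
  show "z + (n + a *\<^sub>R b + l *\<^sub>R d) extreme_point_of Q"
    using edge_endpoints[of n b d] facet_frame_extreme_points[OF assms] by (simp add: add.assoc)
  have "z + (n + a *\<^sub>R b - l *\<^sub>R d) extreme_point_of Q"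
    using edge_endpoints[of n b d] facet_frame_extreme_points[OF assms] by (simp add: add.assoc add_diff_eq)
  then show "z + (n + a *\<^sub>R b + l *\<^sub>R d) \<in> Q" "z + (n + a *\<^sub>R b - l *\<^sub>R d) \<in> Q"
    using \<open>z + (n + a *\<^sub>R b + l *\<^sub>R d) extreme_point_of Q\<close> by (auto simp: extreme_point_of_def)
qed

lemma normal_vertex_le:
  assumes "is_normal m" "facet_frame n b d"
  shows "m \<bullet> n + a * (m \<bullet> b) + l * (m \<bullet> d) \<le> 1" "m \<bullet> n + a * (m \<bullet> b) - l * (m \<bullet> d) \<le> 1"
  using normal_supporting[OF assms(1) vertex_in(1)[OF assms(2)]]
    normal_supporting[OF assms(1) vertex_in(2)[OF assms(2)]]
  by (simp_all add: inner_simps)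

text \<open>
Twice the cosine of the angle by which the normals advance around a vertex; the recurrence that
justifies this is derived from \<open>neighbour_sum\<close>.
\<close>
definition \<tau> where "\<tau> = 4 * (sin (pi / real p))\<^sup>2 / (1 + a\<^sup>2) - 2"

lemma C_eq: "C = 2 * (cos (pi / real p))\<^sup>2 - 1"
  using cos_double_cos[of "pi / real p"] by (simp add: C_def)

lemma S_eq: "S = 2 * sin (pi / real p) * cos (pi / real p)"
  using sin_double[of "pi / real p"] by (simp add: S_def)

text \<open>
The facet with frame \<open>(n, b, d)\<close> has two neighbours at its vertex \<open>v = n + a b + l d\<close>. By symmetry the sum of
their normals is a combination of \<open>n\<close> and \<open>v\<close>, and \<open>\<mu>\<close> is the coefficient of \<open>v\<close>.
\<close>
definition \<mu> where "\<mu> = 2 * c * cos (pi / real p) / r"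

lemma neighbour_sum:
  fixes n b d :: "real^3"
  shows
  "(s *\<^sub>R n + c *\<^sub>R b) + (s *\<^sub>R n + c *\<^sub>R (C *\<^sub>R b + S *\<^sub>R d)) = \<tau> *\<^sub>R n + \<mu> *\<^sub>R (n + a *\<^sub>R b + l *\<^sub>R d)"
proof -
  have 1: "\<mu> * a = c + c * C" "\<mu> * l = c * S"
    using r_pos by (simp_all add: \<mu>_def a_def l_def C_eq S_eq power2_eq_square algebra_simps)
  have "\<mu> = 4 * (cos (pi / real p))\<^sup>2 / (1 + a\<^sup>2)"
    using r_pos by (simp add: \<mu>_def c_def a_def power2_eq_square)
  then have "\<tau> + \<mu> = 4 * ((sin (pi / real p))\<^sup>2 + (cos (pi / real p))\<^sup>2) / (1 + a\<^sup>2) - 2"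
    unfolding \<tau>_def distrib_left add_divide_distrib by simp
  also have "\<dots> = 4 / (1 + a\<^sup>2) - 2"
    by simp
  also have "\<dots> = 2 * s"
    using add_pos_nonneg[of 1 "a\<^sup>2"] by (simp add: s_def field_simps)
  finally have 2: "\<tau> + \<mu> = 2 * s" .
  have "\<tau> *\<^sub>R n + \<mu> *\<^sub>R (n + a *\<^sub>R b + l *\<^sub>R d) = (\<tau> + \<mu>) *\<^sub>R n + (\<mu> * a) *\<^sub>R b + (\<mu> * l) *\<^sub>R d"
    by (simp add: algebra_simps)
  also have "\<dots> = (2 * s) *\<^sub>R n + (c + c * C) *\<^sub>R b + (c * S) *\<^sub>R d"
    by (simp only: 1 2)
  also have "(2 * s) *\<^sub>R n = s *\<^sub>R n + s *\<^sub>R n"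
    by (simp flip: scaleR_add_left)
  finally show ?thesis
    by (simp add: algebra_simps)
qed

text \<open>
Let \<open>x, y, w\<close> be the coordinates of \<open>m\<close> in the frame. The assumption \<open>flip\<close> says that crossing the edge of the
frame does not bring the normal closer to \<open>m\<close>, and \<open>side\<close> that \<open>m\<close> leans towards this edge rather than
towards the other one at the vertex. The second endpoint of the edge gives \<open>w \<ge> 0\<close>, and the two
assumptions together give \<open>w \<le> l x\<close>. Hence \<open>1 = x^2 + y^2 + w^2 \<le> x (x + a y + l w) = x\<close>.
\<close>
lemma normal_eq_of_local_max:
  assumes m: "is_normal m" and fr: "facet_frame n b d"
    and vertex: "m \<bullet> n + a * (m \<bullet> b) + l * (m \<bullet> d) = 1"
    and flip: "m \<bullet> b \<le> a * (m \<bullet> n)" and side: "a * (m \<bullet> d) \<le> l * (m \<bullet> b)"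
  shows "m = n"
proof -
  define x y w where "x = m \<bullet> n" and "y = m \<bullet> b" and "w = m \<bullet> d"
  note O = facet_frame_orthonormal[OF fr]
  note o = orthonormal_frameD[OF O]
  have one: "x\<^sup>2 + y\<^sup>2 + w\<^sup>2 = 1"
    using orthonormal_frame_inner[OF O, of m m] normal_unit[OF m]
    by (simp add: x_def y_def w_def power2_eq_square)
  have eq: "x + a * y + l * w = 1"
    using vertex by (simp add: x_def y_def w_def)
  have "l * w \<ge> 0"
    using normal_vertex_le(2)[OF m fr] eq by (simp add: x_def y_def w_def)
  then have w: "w \<ge> 0"
    using l_pos by (simp add: zero_le_mult_iff)
  have "a * w \<ge> 0"
    using w a_pos by simp
  then have "l * y \<ge> 0"
    using side by (simp add: y_def w_def)
  then have y: "y \<ge> 0"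
    using l_pos by (simp add: zero_le_mult_iff)
  have yx: "y \<le> a * x"
    using flip by (simp add: x_def y_def)
  have "a * x \<ge> 0"
    using y yx by simp
  then have x: "x \<ge> 0"
    using a_pos by (simp add: zero_le_mult_iff)
  have "a * w \<le> l * y"
    using side by (simp add: y_def w_def)
  also have "\<dots> \<le> l * (a * x)"
    using yx l_pos by simp
  finally have "a * w \<le> a * (l * x)"
    by (simp add: mult.left_commute)
  then have "w \<le> l * x"
    using a_pos by simp
  then have "w * w \<le> (l * x) * w"
    using w by (rule mult_right_mono)
  moreover have "y * y \<le> (a * x) * y"
    using yx y by (rule mult_right_mono)
  ultimately have "1 \<le> x * (x + a * y + l * w)"
    using one by (simp add: power2_eq_square algebra_simps)
  then have "1 \<le> x"
    using eq by simp
  then have "1 \<le> x\<^sup>2"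
    by simp
  then have "y\<^sup>2 = 0" "w\<^sup>2 = 0" "x\<^sup>2 = 1"
    using one zero_le_power2[of y] zero_le_power2[of w] by linarith+
  then have "x = 1" "y = 0" "w = 0"
    using x by (auto simp: power2_eq_1_iff)
  then show ?thesis
    using orthonormal_frame_expand[OF O, of m] by (simp add: x_def y_def w_def)
qed

text \<open>
Crossing the edge and then exchanging the two edges at the vertex leads around the vertex: the next crossing
leaves the new facet through its other edge.
\<close>
fun next_frame :: "(real^3) \<times> (real^3) \<times> (real^3) \<Rightarrow> (real^3) \<times> (real^3) \<times> (real^3)" where
  "next_frame (n, b, d) =
    (s *\<^sub>R n + c *\<^sub>R b, C *\<^sub>R (c *\<^sub>R n - s *\<^sub>R b) + S *\<^sub>R d, S *\<^sub>R (c *\<^sub>R n - s *\<^sub>R b) - C *\<^sub>R d)"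

fun frame_vertex :: "(real^3) \<times> (real^3) \<times> (real^3) \<Rightarrow> real^3" where
  "frame_vertex (n, b, d) = n + a *\<^sub>R b + l *\<^sub>R d"

lemma frame_vertex_vertex_reflect:
  fixes n b d :: "real^3"
  shows
  "n + a *\<^sub>R (C *\<^sub>R b + S *\<^sub>R d) + l *\<^sub>R (S *\<^sub>R b - C *\<^sub>R d) = n + a *\<^sub>R b + l *\<^sub>R d"
proof -
  have "n + a *\<^sub>R (C *\<^sub>R b + S *\<^sub>R d) + l *\<^sub>R (S *\<^sub>R b - C *\<^sub>R d) =
      n + (a * C + l * S) *\<^sub>R b + (a * S - l * C) *\<^sub>R d"
    by (simp add: algebra_simps)
  then show ?thesis
    by (simp only: vertex_reflect_rotation)
qed

lemma frame_vertex_flip: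
  fixes n b d :: "real^3"
  shows
  "(s *\<^sub>R n + c *\<^sub>R b) + a *\<^sub>R (c *\<^sub>R n - s *\<^sub>R b) + l *\<^sub>R d = n + a *\<^sub>R b + l *\<^sub>R d"
proof -
  have "(s *\<^sub>R n + c *\<^sub>R b) + a *\<^sub>R (c *\<^sub>R n - s *\<^sub>R b) + l *\<^sub>R d =
      (s + c * a) *\<^sub>R n + (c - s * a) *\<^sub>R b + l *\<^sub>R d"
    by (simp add: algebra_simps)
  then show ?thesis
    by (simp only: flip_rotation(1,2) scaleR_one)
qed

lemma frame_vertex_next: "frame_vertex (next_frame t) = frame_vertex t"
  by (cases t) (simp add: frame_vertex_vertex_reflect frame_vertex_flip)

lemma facet_frame_next:
  "(case t of (n, b, d) \<Rightarrow> facet_frame n b d) \<Longrightarrow>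
    (case next_frame t of (n, b, d) \<Rightarrow> facet_frame n b d)"
  by (cases t) (simp add: facet_frame_vertex_reflect facet_frame_flip)

text \<open>
Going around the vertex \<open>v\<close> from the given facet, the components of the normals orthogonal to \<open>v\<close> turn by a
constant angle. The sequence is periodic, so among its members there is one with positive index that has the largest inner
product with a given normal \<open>m\<close> at \<open>v\<close>. Both neighbours of that member belong to the sequence,
and \<open>normal_eq_of_local_max\<close> applies to one of the two edges that lead to them.
\<close>
lemma normals_at_vertex:
  assumes fr0: "facet_frame n0 b0 d0"
  defines "v \<equiv> n0 + a *\<^sub>R b0 + l *\<^sub>R d0"
  obtains N :: "nat \<Rightarrow> real^3" and \<theta> where
    "range N = {m. is_normal m \<and> m \<bullet> v = 1}" "\<tau> = 2 * cos \<theta>"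
    "cos (real (card (range N)) * \<theta>) = 1"
    "\<And>i. 0 < i \<Longrightarrow> i < card (range N) \<Longrightarrow> cos (real i * \<theta>) \<noteq> 1"
proof -
  define t where "t = (\<lambda>i. (next_frame ^^ i) (n0, b0, d0))"
  define N where "N = (\<lambda>i. fst (t i))"
  define B where "B = (\<lambda>i. fst (snd (t i)))"
  define D where "D = (\<lambda>i. snd (snd (t i)))"
  have t_eq: "t i = (N i, B i, D i)" for i
    by (simp add: N_def B_def D_def)
  have t_Suc: "t (Suc i) = next_frame (t i)" for i
    by (simp add: t_def)
  have "case t i of (n, b, d) \<Rightarrow> facet_frame n b d" for i
  proof (induction i)
    case 0
    then show ?case
      using fr0 by (simp add: t_def)
  next
    case (Suc i)
    then show ?case
      unfolding t_Suc by (rule facet_frame_next)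
  qed
  then have fr: "facet_frame (N i) (B i) (D i)" for i
    by (metis t_eq case_prod_conv)
  have "frame_vertex (t i) = v" for i
    by (induction i) (simp_all add: t_Suc frame_vertex_next, simp add: t_def v_def)
  then have v: "N i + a *\<^sub>R B i + l *\<^sub>R D i = v" for i
    by (simp add: t_eq)
  have Suc: "N (Suc i) = s *\<^sub>R N i + c *\<^sub>R B i"
    "B (Suc i) = C *\<^sub>R (c *\<^sub>R N i - s *\<^sub>R B i) + S *\<^sub>R D i"
    "D (Suc i) = S *\<^sub>R (c *\<^sub>R N i - s *\<^sub>R B i) - C *\<^sub>R D i" for i
    using t_Suc[of i] by (simp_all add: t_eq)
  have CS: "C * C + S * S = 1"
    using sin_cos_squared_add2[of "2 * pi / real p"] by (simp add: C_def S_def power2_eq_square add.commute)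
  have ss: "s * s + c * c = 1"
    using flip_rotation(3) by (simp add: power2_eq_square)
  have previous: "s *\<^sub>R N (Suc i) + c *\<^sub>R (C *\<^sub>R B (Suc i) + S *\<^sub>R D (Suc i)) = N i" for i
  proof -
    have "C *\<^sub>R B (Suc i) + S *\<^sub>R D (Suc i) = (C * C + S * S) *\<^sub>R (c *\<^sub>R N i - s *\<^sub>R B i)"
      unfolding Suc by (simp add: algebra_simps)
    then have eq: "C *\<^sub>R B (Suc i) + S *\<^sub>R D (Suc i) = c *\<^sub>R N i - s *\<^sub>R B i"
      by (simp add: CS)
    have "s *\<^sub>R N (Suc i) + c *\<^sub>R (C *\<^sub>R B (Suc i) + S *\<^sub>R D (Suc i)) = (s * s + c * c) *\<^sub>R N i"
      unfolding eq Suc(1) by (simp add: algebra_simps)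
    then show ?thesis
      by (simp add: ss)
  qed
  have rec: "N (Suc (Suc i)) = \<tau> *\<^sub>R N (Suc i) - N i + \<mu> *\<^sub>R v" for i
  proof -
    have "N (Suc (Suc i)) + N i = \<tau> *\<^sub>R N (Suc i) + \<mu> *\<^sub>R v"
      using neighbour_sum[of "N (Suc i)" "B (Suc i)" "D (Suc i)"]
      unfolding v previous Suc(1)[of "Suc i", symmetric] .
    then show ?thesis
      by (simp add: algebra_simps)
  qed
  note o = orthonormal_frameD[OF facet_frame_orthonormal[OF fr]]
  have Nv: "N i \<bullet> v = 1" for i
    using o[of i] by (simp add: inner_simps flip: v[of i])
  have vv: "v \<bullet> v = 1 + a\<^sup>2 + l\<^sup>2"
    using o[of 0] by (simp add: inner_simps power2_eq_square flip: v[of 0])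
  define V where "V = v \<bullet> v"
  have V: "V > 1"
    using vv a_pos l_pos by (simp add: V_def add_pos_pos)
  have NN: "N i \<bullet> N (Suc i) = s" for i
    using o[of i] by (simp add: Suc inner_simps)
  have "\<tau> *\<^sub>R N 1 = N 2 + N 0 - \<mu> *\<^sub>R v"
    using rec[of 0] by (simp add: numeral_2_eq_2)
  then have "(\<tau> *\<^sub>R N 1) \<bullet> v = (N 2 + N 0 - \<mu> *\<^sub>R v) \<bullet> v"
    "(\<tau> *\<^sub>R N 1) \<bullet> N 1 = (N 2 + N 0 - \<mu> *\<^sub>R v) \<bullet> N 1"
    by simp_all
  moreover have "N 2 \<bullet> N 1 = s" "N 0 \<bullet> N 1 = s" "v \<bullet> N 1 = 1"
    using NN[of 1] NN[of 0] Nv[of 1] by (simp_all add: inner_commute numeral_2_eq_2)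
  ultimately have \<mu>1: "\<mu> * V = 2 - \<tau>" and \<mu>2: "\<tau> = 2 * s - \<mu>"
    using Nv o[of 1] by (simp_all add: inner_simps V_def)
  \<comment> \<open>the component of the normal orthogonal to \<open>v\<close>\<close>
  define x where "x = (\<lambda>i. N i - (1 / V) *\<^sub>R v)"
  define \<rho> where "\<rho> = 1 - 1 / V"
  have \<rho>: "\<rho> > 0"
    using V by (simp add: \<rho>_def)
  have xx: "x i \<bullet> x i = \<rho>" for i
    using o[of i] Nv[of i] V
    by (simp add: x_def \<rho>_def inner_diff_left inner_diff_right inner_commute flip: V_def)
  have x1: "x i \<bullet> x (Suc i) = s - 1 / V" for i
    using NN[of i] Nv[of i] Nv[of "Suc i"] V
    by (simp add: x_def inner_diff_left inner_diff_right inner_commute flip: V_def)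
  have \<mu>V: "\<mu> = (2 - \<tau>) / V"
    using \<mu>1 V by (simp add: eq_divide_eq)
  have s_eq: "s - 1 / V = \<rho> * (\<tau> / 2)"
  proof -
    have "2 * s = \<tau> + (2 - \<tau>) / V"
      using \<mu>2 \<mu>V by simp
    then show ?thesis
      by (simp add: \<rho>_def algebra_simps diff_divide_distrib)
  qed
  have "\<bar>x 0 \<bullet> x 1\<bar> \<le> norm (x 0) * norm (x 1)"
    by (rule Cauchy_Schwarz_ineq2)
  also have "\<dots> = \<rho>"
    using xx \<rho> by (simp add: norm_eq_sqrt_inner)
  finally have "\<rho> * \<bar>\<tau> / 2\<bar> \<le> \<rho> * 1"
    using x1[of 0] s_eq \<rho> by (simp add: abs_mult)
  then have "\<bar>\<tau> / 2\<bar> \<le> 1"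
    using \<rho> mult_le_cancel_left_pos by blast
  define \<theta> where "\<theta> = arccos (\<tau> / 2)"
  have cos: "cos \<theta> = \<tau> / 2"
    using \<open>\<bar>\<tau> / 2\<bar> \<le> 1\<close> unfolding \<theta>_def by (intro cos_arccos_abs)
  have step: "x (Suc (Suc i)) = (2 * cos \<theta>) *\<^sub>R x (Suc i) - x i" for i
  proof -
    have "\<mu> = 1 / V + 1 / V - \<tau> * (1 / V)"
      by (simp add: \<mu>V diff_divide_distrib)
    then have "\<mu> *\<^sub>R v = (1 / V) *\<^sub>R v + (1 / V) *\<^sub>R v - (\<tau> * (1 / V)) *\<^sub>R v"
      by (simp only: scaleR_diff_left scaleR_add_left)
    then show ?thesis
      by (simp add: x_def rec cos scaleR_diff_right)
  qed
  have x1': "x i \<bullet> x (Suc i) = \<rho> * cos \<theta>" for i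
    by (simp only: x1 s_eq cos)
  have N_normal: "is_normal (N i)" for i
    using fr is_normal_def by blast
  have finN: "finite (range N)"
    using finite_normals by (rule finite_subset[rotated]) (use N_normal in auto)
  have "range x = (\<lambda>n. n - (1 / V) *\<^sub>R v) ` range N"
    by (auto simp: x_def)
  then have finx: "finite (range x)" and card: "card (range x) = card (range N)"
    using finN by (simp_all add: card_image inj_on_def)
  note facts = cos_recurrence_finite_range[of x, OF step xx x1' \<rho> finx]
  have "m \<in> range N" if m: "is_normal m" "m \<bullet> v = 1" for m
  proof -
    have fin: "finite ((\<lambda>n. m \<bullet> n) ` range N)"
      using finN by simp
    have "Max ((\<lambda>n. m \<bullet> n) ` range N) \<in> (\<lambda>n. m \<bullet> n) ` range N"
      using fin by (intro Max_in) auto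
    then obtain i where i: "m \<bullet> N i = Max ((\<lambda>n. m \<bullet> n) ` range N)"
      by auto
    \<comment> \<open>adding a period makes the index positive, so that there is a preceding member\<close>
    obtain k where k: "i + card (range N) = Suc k"
      using facts(4) card by (metis add_gr_0 gr0_implies_Suc)
    have "x (Suc k) = x i"
      using facts(3)[of i] by (simp only: card k)
    then have "N (Suc k) = N i"
      by (simp add: x_def)
    then have max: "m \<bullet> N j \<le> m \<bullet> N (Suc k)" for j
      using i fin by simp
    let ?n = "N (Suc k)" and ?b = "B (Suc k)" and ?d = "D (Suc k)"
    have flip: "c * (m \<bullet> b) \<le> c * (a * (m \<bullet> n)) \<Longrightarrow> m \<bullet> b \<le> a * (m \<bullet> n)" for b n
      using flip_rotation(4) by simp
    have "s * (m \<bullet> ?n) + c * (m \<bullet> ?b) \<le> m \<bullet> ?n"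
      using max[of "Suc (Suc k)"] by (simp add: Suc(1)[of "Suc k"] inner_add_right)
    moreover have "(c * a) * (m \<bullet> ?n) = m \<bullet> ?n - s * (m \<bullet> ?n)"
      by (simp only: flip_rotation(5)) (simp add: algebra_simps)
    ultimately have f1: "m \<bullet> ?b \<le> a * (m \<bullet> ?n)"
      by (intro flip) (simp add: mult.assoc)
    let ?b' = "C *\<^sub>R ?b + S *\<^sub>R ?d" and ?d' = "S *\<^sub>R ?b - C *\<^sub>R ?d"
    have "s * (m \<bullet> ?n) + c * (m \<bullet> ?b') \<le> m \<bullet> ?n"
      using max[of k] by (simp only: previous[of k, symmetric] inner_add_right inner_scaleR_right)
    moreover have "(c * a) * (m \<bullet> ?n) = m \<bullet> ?n - s * (m \<bullet> ?n)"
      by (simp only: flip_rotation(5)) (simp add: algebra_simps)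
    ultimately have f2: "m \<bullet> ?b' \<le> a * (m \<bullet> ?n)"
      by (intro flip) (simp add: mult.assoc)
    have v1: "m \<bullet> ?n + a * (m \<bullet> ?b) + l * (m \<bullet> ?d) = 1"
      using m(2) by (simp only: v[of "Suc k", symmetric] inner_add_right inner_scaleR_right)
    have v2: "m \<bullet> ?n + a * (m \<bullet> ?b') + l * (m \<bullet> ?d') = 1"
      using m(2) by (simp only: v[of "Suc k", symmetric] frame_vertex_vertex_reflect[of ?n ?b ?d, symmetric]
          inner_add_right[of m "_ + _"] inner_add_right[of m ?n] inner_scaleR_right)
    have "m = ?n"
    proof (cases "a * (m \<bullet> ?d) \<le> l * (m \<bullet> ?b)")
      case True
      then show ?thesis
        using normal_eq_of_local_max[OF m(1) fr v1 f1] by blast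
    next
      case False
      have "l * (m \<bullet> ?b') - a * (m \<bullet> ?d') = (a * C + l * S) * (m \<bullet> ?d) - (a * S - l * C) * (m \<bullet> ?b)"
        by (simp add: inner_simps algebra_simps)
      also have "\<dots> = a * (m \<bullet> ?d) - l * (m \<bullet> ?b)"
        by (simp only: vertex_reflect_rotation)
      finally have "a * (m \<bullet> ?d') \<le> l * (m \<bullet> ?b')"
        using False by simp
      then show ?thesis
        using normal_eq_of_local_max[OF m(1) facet_frame_vertex_reflect[OF fr] v2 f2] by blast
    qed
    then show ?thesis
      by simp
  qed
  then have "range N = {m. is_normal m \<and> m \<bullet> v = 1}"
    using N_normal Nv by auto
  then show thesis
    using that[of N \<theta>] facts(1,2) cos card by simp
qed

text \<open>For \<open>q = 5\<close> both roots remain possible, the regular pentagon and the pentagram.\<close>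
lemma \<tau>_value:
  "q = 3 \<Longrightarrow> \<tau> = -1" "q = 4 \<Longrightarrow> \<tau> = 0" "q = 5 \<Longrightarrow> \<tau>\<^sup>2 + \<tau> = 1"
proof -
  obtain n b d where fr: "facet_frame n b d"
    using facet_exists facet_normal(1) unfolding is_normal_def by blast
  let ?v = "n + a *\<^sub>R b + l *\<^sub>R d"
  obtain N :: "nat \<Rightarrow> real^3" and \<theta> where N: "range N = {m. is_normal m \<and> m \<bullet> ?v = 1}" "\<tau> = 2 * cos \<theta>"
    "cos (real (card (range N)) * \<theta>) = 1"
    "\<And>i. 0 < i \<Longrightarrow> i < card (range N) \<Longrightarrow> cos (real i * \<theta>) \<noteq> 1"
    by (rule normals_at_vertex[OF fr]) (rule that)
  have "(\<lambda>f. polytope_center f - z) ` {f. f facet_of Q \<and> z + ?v \<in> f} = range N"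
  proof -
    have "z + ?v \<in> f \<longleftrightarrow> (polytope_center f - z) \<bullet> ?v = 1" if "f facet_of Q" for f
    proof -
      have "z + ?v \<in> f \<longleftrightarrow> z + ?v \<in> {x \<in> Q. (polytope_center f - z) \<bullet> (x - z) = 1}"
        by (simp only: facet_normal(2)[OF that])
      then show ?thesis
        using vertex_in(1)[OF fr] by simp
    qed
    then have "(\<lambda>f. polytope_center f - z) ` {f. f facet_of Q \<and> z + ?v \<in> f} =
        {m \<in> (\<lambda>f. polytope_center f - z) ` {f. f facet_of Q}. m \<bullet> ?v = 1}"
      by auto
    also have "(\<lambda>f. polytope_center f - z) ` {f. f facet_of Q} = Collect is_normal"
      using normal_facet_bij by (simp add: bij_betw_def)
    finally show ?thesis
      by (simp add: N(1))
  qed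
  moreover have "inj_on (\<lambda>f. polytope_center f - z) {f. f facet_of Q \<and> z + ?v \<in> f}"
    using normal_facet_bij by (auto simp: bij_betw_def inj_on_def)
  ultimately have "card (range N) = card {f. f facet_of Q \<and> z + ?v \<in> f}"
    using card_image by fastforce
  then have card: "card (range N) = q"
    using degree[OF vertex_in(3)[OF fr]] by (simp only: add.assoc)
  note root = cos_primitive_root[of q \<theta>, folded N(2), OF N(3)[unfolded card] N(4)[unfolded card]]
  show "q = 3 \<Longrightarrow> \<tau> = -1" "q = 4 \<Longrightarrow> \<tau> = 0" "q = 5 \<Longrightarrow> \<tau>\<^sup>2 + \<tau> = 1"
    using root by blast+
qed

end

section \<open>Central symmetry\<close>

text \<open>
The Cayley-Hamilton equation of the product of a crossing and a rotation by one step, in coordinates: this is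
a rotary reflection with determinant -1 and trace \<open>s (1 - C) + C\<close>.
\<close>
lemma coxeter_characteristic_equation:
  fixes s c C S :: real
  assumes "s\<^sup>2 + c\<^sup>2 = 1" "C\<^sup>2 + S\<^sup>2 = 1"
    and "x1 = s * x0 + c * (C * y0 + S * w0)" "y1 = c * x0 - s * (C * y0 + S * w0)" "w1 = C * w0 - S * y0"
    and "x2 = s * x1 + c * (C * y1 + S * w1)" "y2 = c * x1 - s * (C * y1 + S * w1)" "w2 = C * w1 - S * y1"
    and "x3 = s * x2 + c * (C * y2 + S * w2)"
  shows "x3 = (s * (1 - C) + C) * (x2 + x1) - x0"
  using assms by algebra

context regular_solid
begin

text \<open>
The trace of the Coxeter element, in the form that shows its dependence on \<open>p\<close> and \<open>q\<close>: the summand \<open>\<tau>\<close>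
comes from the vertex and \<open>1 + 2 C\<close> is the trace of the rotation of a facet.
\<close>
definition t where "t = \<tau> + 1 + 2 * C"

lemma t_eq: "t = s * (1 - C) + C"
proof -
  have C: "1 - C = 2 * (sin (pi / real p))\<^sup>2"
    by (simp add: C_eq sin_squared_eq)
  have s: "s = 2 / (1 + a\<^sup>2) - 1"
    using add_pos_nonneg[of 1 "a\<^sup>2"] by (simp add: s_def field_simps)
  have "s * (1 - C) = (2 / (1 + a\<^sup>2) - 1) * (2 * (sin (pi / real p))\<^sup>2)"
    by (simp only: C s)
  also have "\<dots> = \<tau> + 2 - (1 - C)"
    unfolding C \<tau>_def by (simp add: left_diff_distrib)
  finally have "s * (1 - C) = \<tau> + 2 - (1 - C)" .
  then show ?thesis
    by (simp add: t_def)
qed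

lemma facet_frame_coxeter:
  assumes "facet_frame n b d"
  shows "facet_frame (s *\<^sub>R n + c *\<^sub>R (C *\<^sub>R b + S *\<^sub>R d)) (c *\<^sub>R n - s *\<^sub>R (C *\<^sub>R b + S *\<^sub>R d)) (C *\<^sub>R d - S *\<^sub>R b)"
  using facet_frame_flip[OF facet_frame_reflect[OF facet_frame_vertex_reflect[OF assms]]] by simp

fun coxeter :: "(real^3) \<times> (real^3) \<times> (real^3) \<Rightarrow> (real^3) \<times> (real^3) \<times> (real^3)" where
  "coxeter (n, b, d) = (s *\<^sub>R n + c *\<^sub>R (C *\<^sub>R b + S *\<^sub>R d), c *\<^sub>R n - s *\<^sub>R (C *\<^sub>R b + S *\<^sub>R d), C *\<^sub>R d - S *\<^sub>R b)"

lemma coxeter_recurrence: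
  assumes "is_normal n"
  obtains N :: "nat \<Rightarrow> real^3" where "N 0 = n" "\<And>i. is_normal (N i)"
    "\<And>i. N (Suc (Suc (Suc i))) = t *\<^sub>R (N (Suc (Suc i)) + N (Suc i)) - N i"
proof -
  obtain b d where fr0: "facet_frame n b d"
    using assms by (auto simp: is_normal_def)
  define f where "f = (\<lambda>i. (coxeter ^^ i) (n, b, d))"
  define N where "N = (\<lambda>i. fst (f i))"
  define B where "B = (\<lambda>i. fst (snd (f i)))"
  define D where "D = (\<lambda>i. snd (snd (f i)))"
  have f_eq: "f i = (N i, B i, D i)" for i
    by (simp add: N_def B_def D_def)
  have "f (Suc i) = coxeter (f i)" for i
    by (simp add: f_def)
  then have step: "N (Suc i) = s *\<^sub>R N i + c *\<^sub>R (C *\<^sub>R B i + S *\<^sub>R D i)"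
    "B (Suc i) = c *\<^sub>R N i - s *\<^sub>R (C *\<^sub>R B i + S *\<^sub>R D i)"
    "D (Suc i) = C *\<^sub>R D i - S *\<^sub>R B i" for i
    by (simp_all add: f_eq)
  have 0: "N 0 = n" "B 0 = b" "D 0 = d"
    by (simp_all add: N_def B_def D_def f_def)
  have fr: "facet_frame (N i) (B i) (D i)" for i
  proof (induction i)
    case (Suc i)
    then show ?case
      unfolding step by (rule facet_frame_coxeter)
  qed (simp add: 0 fr0)
  have CS: "C\<^sup>2 + S\<^sup>2 = 1"
    by (simp add: C_def S_def)
  have "N (Suc (Suc (Suc i))) = t *\<^sub>R (N (Suc (Suc i)) + N (Suc i)) - N i" for i
  proof (rule vector_eq_rdot[THEN iffD1, rule_format])
    fix e
    have inner: "N (Suc i) \<bullet> e = s * (N i \<bullet> e) + c * (C * (B i \<bullet> e) + S * (D i \<bullet> e))"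
      "B (Suc i) \<bullet> e = c * (N i \<bullet> e) - s * (C * (B i \<bullet> e) + S * (D i \<bullet> e))"
      "D (Suc i) \<bullet> e = C * (D i \<bullet> e) - S * (B i \<bullet> e)" for i
      by (simp_all add: step inner_simps)
    have "N (Suc (Suc (Suc i))) \<bullet> e = t * (N (Suc (Suc i)) \<bullet> e + N (Suc i) \<bullet> e) - N i \<bullet> e"
      unfolding t_eq
      by (rule coxeter_characteristic_equation[OF flip_rotation(3) CS inner inner inner(1)])
    then show "N (Suc (Suc (Suc i))) \<bullet> e = (t *\<^sub>R (N (Suc (Suc i)) + N (Suc i)) - N i) \<bullet> e"
      by (simp add: inner_simps)
  qed
  then show thesis
    using that[of N] 0(1) fr unfolding is_normal_def by blast
qed

text \<open>
Write \<open>K\<close> for the Coxeter element. For \<open>t = 0\<close> its characteristic equation reads \<open>K^3 = -1\<close>; for \<open>t^2 + t = 1\<close>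
the polynomial \<open>X^3 - t X^2 - t X + 1\<close> divides \<open>X^5 + 1\<close>.
\<close>
lemma normals_symmetric:
  assumes t: "t = 0 \<or> t\<^sup>2 + t = 1" and n: "is_normal n"
  shows "is_normal (- n)"
proof -
  obtain N where N: "N 0 = n" "\<And>i. is_normal (N i)"
    and rec: "\<And>i. N (Suc (Suc (Suc i))) = t *\<^sub>R (N (Suc (Suc i)) + N (Suc i)) - N i"
    by (rule coxeter_recurrence[OF n]) (rule that)
  from t show ?thesis
  proof
    assume "t = 0"
    then have "N 3 = - n"
      using rec[of 0] N(1) by (simp add: numeral_3_eq_3)
    then show ?thesis
      using N(2)[of 3] by simp
  next
    assume t: "t\<^sup>2 + t = 1"
    have r: "N 3 = t *\<^sub>R (N 2 + N 1) - n" "N 4 = t *\<^sub>R (N 3 + N 2) - N 1" "N 5 = t *\<^sub>R (N 4 + N 3) - N 2"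
      using rec[of 0] rec[of 1] rec[of 2] N(1) by (simp_all add: eval_nat_numeral)
    have "N 5 = - n"
    proof (rule vector_eq_rdot[THEN iffD1, rule_format])
      fix e
      have "N 3 \<bullet> e = t * (N 2 \<bullet> e + N 1 \<bullet> e) - n \<bullet> e" "N 4 \<bullet> e = t * (N 3 \<bullet> e + N 2 \<bullet> e) - N 1 \<bullet> e"
        "N 5 \<bullet> e = t * (N 4 \<bullet> e + N 3 \<bullet> e) - N 2 \<bullet> e"
        by (subst r, simp add: inner_simps)+
      then have "N 5 \<bullet> e = - (n \<bullet> e)"
        using t by algebra
      then show "N 5 \<bullet> e = (- n) \<bullet> e"
        by simp
    qed
    then show ?thesis
      using N(2)[of 5] by simp
  qed
qed

section \<open>Sums of squared distances\<close>

lemma distinct_pairs_image: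
  assumes "inj_on g A"
  shows "{h x y | x y. x \<in> g ` A \<and> y \<in> g ` A \<and> x \<noteq> y} =
    {h (g u) (g v) | u v. u \<in> A \<and> v \<in> A \<and> u \<noteq> v}"
proof (intro equalityI subsetI)
  fix w assume "w \<in> {h (g u) (g v) | u v. u \<in> A \<and> v \<in> A \<and> u \<noteq> v}"
  then obtain u v where uv: "w = h (g u) (g v)" "u \<in> A" "v \<in> A" "u \<noteq> v"
    by blast
  then have "g u \<noteq> g v"
    using assms by (simp add: inj_on_eq_iff)
  then show "w \<in> {h x y | x y. x \<in> g ` A \<and> y \<in> g ` A \<and> x \<noteq> y}"
    using uv by blast
qed blast

definition inner_products where
  "inner_products = {m \<bullet> n | m n. is_normal m \<and> is_normal n \<and> m \<noteq> n}"

lemma finite_inner_products: "finite inner_products"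
proof -
  have "inner_products \<subseteq> (\<lambda>(m, n). m \<bullet> n) ` (Collect is_normal \<times> Collect is_normal)"
    by (auto simp: inner_products_def)
  then show ?thesis
    using finite_normals finite_subset by blast
qed

lemma normal_eq_iff_inner: "is_normal m \<Longrightarrow> is_normal n \<Longrightarrow> m \<bullet> n = 1 \<longleftrightarrow> m = n"
proof
  assume "is_normal m" "is_normal n" "m \<bullet> n = 1"
  then have "(m - n) \<bullet> (m - n) = 0"
    using normal_unit by (simp add: inner_diff_left inner_diff_right inner_commute)
  then show "m = n"
    by simp
qed (use normal_unit in auto)

lemma one_notin_inner_products: "1 \<notin> inner_products"
  using normal_eq_iff_inner unfolding inner_products_def by force

lemma inner_products_le_1: "x \<in> inner_products \<Longrightarrow> x \<le> 1"
proof -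
  assume "x \<in> inner_products"
  then obtain m n where mn: "x = m \<bullet> n" "is_normal m" "is_normal n"
    by (auto simp: inner_products_def)
  then have "m \<bullet> n \<le> norm m * norm n"
    by (intro norm_cauchy_schwarz)
  then show "x \<le> 1"
    using mn normal_unit by (simp add: norm_eq_sqrt_inner)
qed

lemma facet_center_distances_eq:
  "facet_center_distances Q = (\<lambda>x. sqrt (2 - 2 * x)) ` inner_products"
proof -
  have dist: "dist m n = sqrt (2 - 2 * (m \<bullet> n))" if "is_normal m" "is_normal n" for m n
  proof -
    have "(m - n) \<bullet> (m - n) = 2 - 2 * (m \<bullet> n)"
      using that normal_unit by (simp add: inner_diff_left inner_diff_right inner_commute)
    then show ?thesis
      by (simp add: dist_norm norm_eq_sqrt_inner)
  qed
  have "facet_center_distances Q =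
      {dist m n | m n. m \<in> Collect is_normal \<and> n \<in> Collect is_normal \<and> m \<noteq> n}"
  proof -
    let ?g = "\<lambda>f. polytope_center f - z" and ?F = "{f. f facet_of Q}"
    have inj: "inj_on ?g ?F" and im: "?g ` ?F = Collect is_normal"
      using normal_facet_bij by (auto simp: bij_betw_def)
    have "dist (polytope_center f) (polytope_center g) = dist (?g f) (?g g)" for f g :: "(real^3) set"
      by (simp add: dist_norm)
    then have "facet_center_distances Q = {dist (?g f) (?g g) | f g. f \<in> ?F \<and> g \<in> ?F \<and> f \<noteq> g}"
      by (simp add: facet_center_distances_def)
    also have "\<dots> = {dist m n | m n. m \<in> ?g ` ?F \<and> n \<in> ?g ` ?F \<and> m \<noteq> n}"
      by (rule distinct_pairs_image[OF inj, symmetric])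
    finally show ?thesis
      by (simp only: im)
  qed
  also have "\<dots> = {sqrt (2 - 2 * (m \<bullet> n)) | m n. is_normal m \<and> is_normal n \<and> m \<noteq> n}"
    using dist by (metis (no_types, opaque_lifting) mem_Collect_eq)
  also have "\<dots> = (\<lambda>x. sqrt (2 - 2 * x)) ` inner_products"
    by (auto simp: inner_products_def)
  finally show ?thesis .
qed

lemma card_distances: "card (facet_center_distances Q) = card inner_products"
  unfolding facet_center_distances_eq by (rule card_image) (auto simp: inj_on_def)

text \<open>
Equal distances correspond to equal inner products, so the sum over the distinct distances is a sum over the
distinct inner products.
\<close>
lemma sum_distances:
  "(\<Sum>t\<in>facet_center_distances Q. t\<^sup>2) = 2 * real (card inner_products) - 2 * \<Sum>inner_products"
proof -
  have "(\<Sum>t\<in>facet_center_distances Q. t\<^sup>2) = (\<Sum>x\<in>inner_products. (sqrt (2 - 2 * x))\<^sup>2)"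
    unfolding facet_center_distances_eq by (subst sum.reindex) (auto simp: inj_on_def)
  also have "\<dots> = (\<Sum>x\<in>inner_products. 2 - 2 * x)"
    using inner_products_le_1 by (intro sum.cong) auto
  finally show ?thesis
    by (simp add: sum_subtractf sum_distrib_left)
qed

text \<open>
Replacing \<open>n\<close> by \<open>-n\<close> negates \<open>m \<bullet> n\<close>. It leads outside the inner products of distinct normals only if \<open>m = -n\<close>,
with the value 1; so the value 1 is added to the set, whose sum is then 0.
\<close>
lemma sum_distances_symmetric:
  assumes sym: "\<And>n. is_normal n \<Longrightarrow> is_normal (- n)"
  shows "(\<Sum>t\<in>facet_center_distances Q. t\<^sup>2) = 2 * real (card (facet_center_distances Q)) + 2"
proof -
  let ?I = "insert 1 inner_products"
  have "- x \<in> ?I" if "x \<in> ?I" for x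
  proof -
    have "\<exists>m n. is_normal m \<and> is_normal n \<and> x = m \<bullet> n"
    proof (cases "x = 1")
      case True
      obtain f where "f facet_of Q"
        using facet_exists by blast
      then show ?thesis
        using True facet_normal(1) normal_unit by metis
    next
      case False
      then show ?thesis
        using that by (auto simp: inner_products_def)
    qed
    then obtain m n where mn: "is_normal m" "is_normal n" "x = m \<bullet> n"
      by blast
    have x: "- x = m \<bullet> (- n)"
      by (simp add: mn)
    show ?thesis
    proof (cases "m = - n")
      case True
      then show ?thesis
        using x mn normal_unit[of m] by simp
    next
      case False
      then show ?thesis
        unfolding x inner_products_def using mn sym by blast
    qed
  qed
  then have "(\<Sum>x\<in>?I. - x) = (\<Sum>x\<in>?I. x)"
    by (intro sum.reindex_bij_witness[where i = uminus and j = uminus]) auto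
  then have "\<Sum>?I = 0"
    by (simp only: sum_negf)
  then have "\<Sum>inner_products = - 1"
    using finite_inner_products one_notin_inner_products by simp
  then show ?thesis
    by (simp add: sum_distances card_distances)
qed

section \<open>The tetrahedron, the cube and the octahedron\<close>

lemma triangle_values:
  assumes "p = 3"
  shows "C = - 1 / 2" "l = sqrt 3 * a" "S = sqrt 3 / 2" "\<tau> = 3 / (1 + a\<^sup>2) - 2"
proof -
  show "C = - 1 / 2"
    unfolding C_def unfolding assms using cos_double_cos[of "pi / 3"] by (simp add: cos_60 power_divide)
  show "l = sqrt 3 * a"
    unfolding l_def a_def unfolding assms by (simp add: sin_60 cos_60)
  show "S = sqrt 3 / 2"
    unfolding S_def unfolding assms using sin_double[of "pi / 3"] by (simp add: sin_60 cos_60)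
  have "(sin (pi / real p))\<^sup>2 = 3 / 4"
    unfolding assms by (simp add: sin_60 power_divide)
  then show "\<tau> = 3 / (1 + a\<^sup>2) - 2"
    by (simp add: \<tau>_def)
qed

lemma is_normal_flip: "facet_frame n b d \<Longrightarrow> is_normal (s *\<^sub>R n + c *\<^sub>R b)"
  using facet_frame_flip unfolding is_normal_def by blast

text \<open>The third vertex of a triangular facet, opposite to the edge of the frame, is \<open>n - 2 a b\<close>.\<close>
lemma normal_triangle_vertex_le:
  assumes p: "p = 3" and m: "is_normal m" and fr: "facet_frame n b d"
  shows "m \<bullet> n - 2 * a * (m \<bullet> b) \<le> 1"
proof -
  note v = triangle_values[OF p]
  have "m \<bullet> n + a * (m \<bullet> (C *\<^sub>R b + S *\<^sub>R d)) - l * (m \<bullet> (S *\<^sub>R b - C *\<^sub>R d)) \<le> 1"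
    by (rule normal_vertex_le(2)[OF m facet_frame_vertex_reflect[OF fr]])
  moreover have "a * (m \<bullet> (C *\<^sub>R b + S *\<^sub>R d)) - l * (m \<bullet> (S *\<^sub>R b - C *\<^sub>R d)) =
      (a * C - l * S) * (m \<bullet> b) + (a * S + l * C) * (m \<bullet> d)"
    by (simp add: inner_simps algebra_simps)
  moreover have "sqrt 3 * (sqrt 3 * a) = 3 * a"
    by (simp flip: mult.assoc)
  then have "a * C - l * S = - 2 * a" "a * S + l * C = 0"
    by (simp_all add: v algebra_simps)
  ultimately show ?thesis
    by simp
qed

text \<open>
The vertices \<open>v\<close> are those of one facet and \<open>-3 n\<close>. For a normal \<open>m\<close> the four numbers \<open>1 - m \<bullet> v\<close> are
nonnegative, their sum is 4, and since the vertices form a tight frame the sum of their squares is 16. So all of them but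
one vanish, and the one at \<open>-3 n\<close>, which is \<open>1 + 3 (m \<bullet> n)\<close>, is 0 or 4.
\<close>
lemma tetrahedron_inner_products:
  assumes p: "p = 3" and q: "q = 3"
  shows "inner_products \<subseteq> {- 1 / 3}"
proof -
  note val = triangle_values[OF p]
  have "3 / (1 + a\<^sup>2) = 1"
    using \<tau>_value(1)[OF q] val(4) by simp
  then have a2: "a\<^sup>2 = 2"
    using add_pos_nonneg[of 1 "a\<^sup>2"] by (simp add: field_simps)
  have l2: "l\<^sup>2 = 6"
    by (simp add: val power_mult_distrib a2)
  have s: "s = - 1 / 3" and c: "c = 2 * a / 3"
    by (simp_all add: s_def c_def a2)
  have "m \<bullet> n = 1 \<or> m \<bullet> n = - 1 / 3" if m: "is_normal m" and n: "is_normal n" for m n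
  proof -
    obtain b d where fr: "facet_frame n b d"
      using n by (auto simp: is_normal_def)
    define x y w where "x = m \<bullet> n" and "y = m \<bullet> b" and "w = m \<bullet> d"
    have one: "x\<^sup>2 + y\<^sup>2 + w\<^sup>2 = 1"
      using orthonormal_frame_inner[OF facet_frame_orthonormal[OF fr], of m m] normal_unit[OF m]
      by (simp add: x_def y_def w_def power2_eq_square)
    define g1 g2 g3 g4 where "g1 = 1 - (x + a * y + l * w)" and "g2 = 1 - (x + a * y - l * w)"
      and "g3 = 1 - (x - 2 * a * y)" and "g4 = 1 + 3 * x"
    have nonneg: "g1 \<ge> 0" "g2 \<ge> 0" "g3 \<ge> 0"
      using normal_vertex_le[OF m fr] normal_triangle_vertex_le[OF p m fr]
      by (simp_all add: g1_def g2_def g3_def x_def y_def w_def)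
    have g4: "g4 \<ge> 0"
    proof -
      have "(s * x + c * y) - 2 * a * (c * x - s * y) \<le> 1"
        using normal_triangle_vertex_le[OF p m facet_frame_flip[OF fr]]
        by (simp add: x_def y_def inner_simps)
      moreover have "(s * x + c * y) - 2 * a * (c * x - s * y) = - x / 3 - 4 / 3 * a\<^sup>2 * x"
        by (simp add: s c power2_eq_square algebra_simps)
      ultimately show ?thesis
        by (simp add: a2 g4_def)
    qed
    have sum: "g1 + g2 + g3 + g4 = 4"
      by (simp add: g1_def g2_def g3_def g4_def)
    have "g1\<^sup>2 + g2\<^sup>2 + g3\<^sup>2 + g4\<^sup>2 = 4 + 12 * x\<^sup>2 + 6 * a\<^sup>2 * y\<^sup>2 + 2 * l\<^sup>2 * w\<^sup>2"
      by (simp add: g1_def g2_def g3_def g4_def power2_eq_square algebra_simps)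
    also have "\<dots> = 4 + 12 * (x\<^sup>2 + y\<^sup>2 + w\<^sup>2)"
      by (simp add: a2 l2)
    also have "\<dots> = (g1 + g2 + g3 + g4)\<^sup>2"
      by (simp add: one sum)
    finally have zero: "g1 * g2 + g1 * g3 + g2 * g3 + g4 * (g1 + g2 + g3) = 0"
      by (simp add: power2_eq_square algebra_simps)
    have "g1 * g2 \<ge> 0" "g1 * g3 \<ge> 0" "g2 * g3 \<ge> 0" "g4 * (g1 + g2 + g3) \<ge> 0"
      using nonneg g4 by simp_all
    then have "g4 * (g1 + g2 + g3) = 0"
      using zero by linarith
    moreover have "g1 + g2 + g3 = 4 - g4"
      using sum by simp
    ultimately show ?thesis
      by (auto simp: g4_def x_def)
  qed
  then show ?thesis
    unfolding inner_products_def using normal_eq_iff_inner by blast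
qed

text \<open>
Here \<open>a = l = 1\<close>, the vertices are the sums \<open>\<plusminus>n \<plusminus> b \<plusminus> d\<close>, and the coordinates of a normal satisfy
\<open>\<bar>x\<bar> + \<bar>y\<bar> + \<bar>w\<bar> \<le> 1 = x^2 + y^2 + w^2\<close>. This leaves the six vectors \<open>\<plusminus>n\<close>, \<open>\<plusminus>b\<close>, \<open>\<plusminus>d\<close>.
\<close>
lemma cube_normals:
  assumes p: "p = 4" and q: "q = 3"
  shows "card (Collect is_normal) = 6" "card inner_products = 2"
proof -
  have C: "C = 0" and S: "S = 1"
    unfolding C_def S_def unfolding p by simp_all
  have al: "l = a"
    unfolding a_def l_def unfolding p by (simp add: sin_45 cos_45)
  have sin2: "(sin (pi / real p))\<^sup>2 = 1 / 2"
    unfolding p by (simp add: sin_45 power_divide)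
  have "2 / (1 + a\<^sup>2) = 1"
    using \<tau>_value(1)[OF q] unfolding \<tau>_def sin2 by simp
  then have "a\<^sup>2 = 1"
    using add_pos_nonneg[of 1 "a\<^sup>2"] by (simp add: field_simps)
  then have a: "a = 1"
    using a_pos by (auto simp: power2_eq_1_iff)
  have s: "s = 0" and c: "c = 1"
    by (simp_all add: s_def c_def a)
  have "t = 0"
    using \<tau>_value(1)[OF q] by (simp add: t_def C)
  then have sym: "is_normal (- n)" if "is_normal n" for n
    using normals_symmetric that by blast
  obtain n b d where fr: "facet_frame n b d"
    using facet_exists facet_normal(1) unfolding is_normal_def by blast
  note o = orthonormal_frameD[OF facet_frame_orthonormal[OF fr]]
  have fr1: "facet_frame n d b"
    using facet_frame_vertex_reflect[OF fr] by (simp add: C S)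
  have fr2: "facet_frame n (- b) d"
    using facet_frame_vertex_reflect[OF facet_frame_reflect[OF fr1]] by (simp add: C S)
  let ?N = "{n, - n, b, - b, d, - d}"
  have "is_normal n" "is_normal b" "is_normal d"
    using is_normal_flip[OF fr] is_normal_flip[OF fr1] fr by (auto simp: s c is_normal_def)
  then have "?N \<subseteq> Collect is_normal"
    using sym by auto
  moreover have "m \<in> ?N" if m: "is_normal m" for m
  proof -
    define x y w where "x = m \<bullet> n" and "y = m \<bullet> b" and "w = m \<bullet> d"
    have one: "x\<^sup>2 + y\<^sup>2 + w\<^sup>2 = 1"
      using orthonormal_frame_inner[OF facet_frame_orthonormal[OF fr], of m m] normal_unit[OF m]
      by (simp add: x_def y_def w_def power2_eq_square)
    have "\<bar>x\<bar> + \<bar>y\<bar> + \<bar>w\<bar> \<le> 1"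
      using normal_vertex_le[OF m fr] normal_vertex_le[OF sym[OF m] fr]
        normal_vertex_le[OF m fr2] normal_vertex_le[OF sym[OF m] fr2]
      by (simp add: al a x_def y_def w_def abs_if)
    then have "(\<bar>x\<bar> + \<bar>y\<bar> + \<bar>w\<bar>)\<^sup>2 \<le> 1"
      by (simp add: power_le_one)
    then have "\<bar>x\<bar> * \<bar>y\<bar> + \<bar>y\<bar> * \<bar>w\<bar> + \<bar>x\<bar> * \<bar>w\<bar> \<le> 0"
      using one by (simp add: power2_eq_square algebra_simps)
    moreover have "\<bar>x\<bar> * \<bar>y\<bar> \<ge> 0" "\<bar>y\<bar> * \<bar>w\<bar> \<ge> 0" "\<bar>x\<bar> * \<bar>w\<bar> \<ge> 0"
      by simp_all
    ultimately have "\<bar>x\<bar> * \<bar>y\<bar> = 0" "\<bar>y\<bar> * \<bar>w\<bar> = 0" "\<bar>x\<bar> * \<bar>w\<bar> = 0"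
      by linarith+
    then consider "y = 0" "w = 0" "x = 1 \<or> x = - 1" | "x = 0" "w = 0" "y = 1 \<or> y = - 1"
      | "x = 0" "y = 0" "w = 1 \<or> w = - 1"
      using one by (auto simp: power2_eq_1_iff)
    moreover have "m = x *\<^sub>R n + y *\<^sub>R b + w *\<^sub>R d"
      unfolding x_def y_def w_def by (rule orthonormal_frame_expand[OF facet_frame_orthonormal[OF fr]])
    ultimately show ?thesis
      by cases auto
  qed
  ultimately have N: "Collect is_normal = ?N"
    by auto
  have "distinct (map (\<lambda>v. (v \<bullet> n, v \<bullet> b, v \<bullet> d)) [n, - n, b, - b, d, - d])"
    using o by simp
  then have dist: "distinct [n, - n, b, - b, d, - d]"
    by (simp only: distinct_map)
  show "card (Collect is_normal) = 6"
    unfolding N using distinct_card[OF dist] by simp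
  have "inner_products = {m \<bullet> m' | m m'. m \<in> ?N \<and> m' \<in> ?N \<and> m \<noteq> m'}"
    unfolding inner_products_def N[symmetric] by simp
  also have "\<dots> = {0, - 1}"
  proof (intro equalityI subsetI)
    fix x assume "x \<in> {m \<bullet> m' | m m'. m \<in> ?N \<and> m' \<in> ?N \<and> m \<noteq> m'}"
    then show "x \<in> {0, - 1}"
      using o by auto
  next
    have "n \<noteq> b" "n \<noteq> - n"
      using dist by auto
    let ?X = "{m \<bullet> m' | m m'. m \<in> ?N \<and> m' \<in> ?N \<and> m \<noteq> m'}"
    have "n \<bullet> b \<in> ?X" "n \<bullet> (- n) \<in> ?X"
      using \<open>n \<noteq> b\<close> \<open>n \<noteq> - n\<close> by blast+
    then have "0 \<in> ?X" "- 1 \<in> ?X"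
      by (simp_all only: inner_minus_right o)
    then show "x \<in> ?X" if "x \<in> {0, - 1}" for x
      using that by (elim insertE emptyE) (simp_all only:)
  qed
  finally show "card inner_products = 2"
    by simp
qed

text \<open>
The vertices of one facet are pairwise orthogonal vectors \<open>v\<close> of squared length 3. By symmetry of the normals
each normal \<open>m\<close> satisfies \<open>\<bar>m \<bullet> v\<bar> \<le> 1\<close>, while the squares of these three numbers add up to 3. So \<open>m\<close> is
one of the eight vectors \<open>(\<plusminus>v1 \<plusminus> v2 \<plusminus> v3) / 3\<close>, and crossing the three edges of the facet and
negating shows that all of them occur.
\<close>
lemma octahedron_normals:
  assumes p: "p = 3" and q: "q = 4"
  shows "card (Collect is_normal) = 8" "card inner_products = 3"
proof -
  note val = triangle_values[OF p]
  have "3 / (1 + a\<^sup>2) = 2"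
    using \<tau>_value(2)[OF q] val(4) by simp
  then have a2: "a\<^sup>2 = 1 / 2"
    using add_pos_nonneg[of 1 "a\<^sup>2"] by (simp add: field_simps)
  have l2: "l\<^sup>2 = 3 / 2"
    by (simp add: val power_mult_distrib a2)
  have s: "s = 1 / 3" and c: "c = 4 / 3 * a"
    by (simp_all add: s_def c_def a2)
  have "t = 0"
    using \<tau>_value(2)[OF q] by (simp add: t_def val)
  then have sym: "is_normal (- n)" if "is_normal n" for n
    using normals_symmetric that by blast
  obtain n b d where fr: "facet_frame n b d"
    using facet_exists facet_normal(1) unfolding is_normal_def by blast
  note O = facet_frame_orthonormal[OF fr]
  note o = orthonormal_frameD[OF O]
  define v1 v2 v3 where "v1 = n + a *\<^sub>R b + l *\<^sub>R d" and "v2 = n + a *\<^sub>R b - l *\<^sub>R d"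
    and "v3 = n - (2 * a) *\<^sub>R b"
  have vv: "v1 \<bullet> v1 = 3" "v2 \<bullet> v2 = 3" "v3 \<bullet> v3 = 3" "v1 \<bullet> v2 = 0" "v1 \<bullet> v3 = 0" "v2 \<bullet> v3 = 0"
    using o a2 l2 by (simp_all add: v1_def v2_def v3_def inner_simps power2_eq_square)
  have vv': "v2 \<bullet> v1 = 0" "v3 \<bullet> v1 = 0" "v3 \<bullet> v2 = 0"
    using vv by (simp_all add: inner_commute)
  have VO: "orthonormal_frame (v1 /\<^sub>R sqrt 3) (v2 /\<^sub>R sqrt 3) (v3 /\<^sub>R sqrt 3)"
  proof -
    have "inverse (sqrt 3) * (inverse (sqrt 3) * 3) = 1"
      by (simp add: field_simps)
    then show ?thesis
      using vv by (simp add: orthonormal_frame_def)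
  qed
  define G where "G = (\<lambda>(e1 :: real, e2, e3). (1 / 3) *\<^sub>R (e1 *\<^sub>R v1 + e2 *\<^sub>R v2 + e3 *\<^sub>R v3))"
  let ?E = "{1, - 1 :: real} \<times> {1, - 1 :: real} \<times> {1, - 1 :: real}"
  have GG: "G (e1, e2, e3) \<bullet> G (f1, f2, f3) = (e1 * f1 + e2 * f2 + e3 * f3) / 3" for e1 e2 e3 f1 f2 f3
    using vv vv' by (simp add: G_def inner_simps algebra_simps)
  have Gn: "G (e1, e2, e3) \<bullet> v1 = e1" "G (e1, e2, e3) \<bullet> v2 = e2" "G (e1, e2, e3) \<bullet> v3 = e3" for e1 e2 e3
    using vv vv' by (simp_all add: G_def inner_simps)
  have inj: "inj_on G ?E"
  proof (rule inj_onI)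
    fix e f assume "G e = G f"
    then show "e = f"
      using Gn by (metis prod_cases3)
  qed
  have N: "Collect is_normal = G ` ?E"
  proof (intro equalityI subsetI)
    fix m assume "m \<in> Collect is_normal"
    then have m: "is_normal m"
      by simp
    define e1 e2 e3 where "e1 = m \<bullet> v1" and "e2 = m \<bullet> v2" and "e3 = m \<bullet> v3"
    have sum: "e1\<^sup>2 + e2\<^sup>2 + e3\<^sup>2 = 3"
      using orthonormal_frame_inner[OF VO, of m m] normal_unit[OF m]
      by (simp add: e1_def e2_def e3_def power2_eq_square field_simps)
    have "\<bar>e1\<bar> \<le> 1" "\<bar>e2\<bar> \<le> 1" "\<bar>e3\<bar> \<le> 1"
      using normal_vertex_le[OF m fr] normal_vertex_le[OF sym[OF m] fr]
        normal_triangle_vertex_le[OF p m fr] normal_triangle_vertex_le[OF p sym[OF m] fr]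
      by (simp_all add: e1_def e2_def e3_def v1_def v2_def v3_def inner_simps abs_le_iff)
    then have "e1\<^sup>2 \<le> 1" "e2\<^sup>2 \<le> 1" "e3\<^sup>2 \<le> 1"
      by (simp_all add: abs_square_le_1)
    then have "e1\<^sup>2 = 1" "e2\<^sup>2 = 1" "e3\<^sup>2 = 1"
      using sum by linarith+
    then have "(e1, e2, e3) \<in> ?E"
      by (auto simp: power2_eq_1_iff)
    moreover have "m = G (e1, e2, e3)"
    proof -
      have third: "(m \<bullet> (v /\<^sub>R sqrt 3)) *\<^sub>R (v /\<^sub>R sqrt 3) = (1 / 3) *\<^sub>R (m \<bullet> v) *\<^sub>R v" for v
      proof -
        have "(inverse (sqrt 3) * (m \<bullet> v)) * inverse (sqrt 3) = 1 / 3 * (m \<bullet> v)"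
          by (simp add: field_simps)
        then show ?thesis
          by (simp only: inner_scaleR_right scaleR_scaleR)
      qed
      show ?thesis
        by (subst orthonormal_frame_expand[OF VO, of m])
          (simp only: third G_def e1_def e2_def e3_def prod.case scaleR_add_right)
    qed
    ultimately show "m \<in> G ` ?E"
      by blast
  next
    have eqI: "x = y" if "\<And>e. x \<bullet> e = y \<bullet> e" for x y :: "real^3"
      using that vector_eq_rdot by blast
    have "G (1, 1, 1) = n" "G (1, 1, - 1) = s *\<^sub>R n + c *\<^sub>R b"
      "G (1, - 1, 1) = s *\<^sub>R n + c *\<^sub>R (C *\<^sub>R b + S *\<^sub>R d)"
      "G (- 1, 1, 1) = s *\<^sub>R n + c *\<^sub>R (C *\<^sub>R b + S *\<^sub>R (- d))"
      by (rule eqI, simp only: G_def prod.case v1_def v2_def v3_def inner_simps inner_minus_left,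
          simp add: s c val field_simps)+
    then have "is_normal (G (1, 1, 1))" "is_normal (G (1, 1, - 1))" "is_normal (G (1, - 1, 1))"
      "is_normal (G (- 1, 1, 1))"
      using fr is_normal_flip[OF fr] is_normal_flip[OF facet_frame_vertex_reflect[OF fr]]
        is_normal_flip[OF facet_frame_vertex_reflect[OF facet_frame_reflect[OF fr]]]
      by (auto simp: is_normal_def)
    moreover have "is_normal (G (- e1, - e2, - e3))" if "is_normal (G (e1, e2, e3))" for e1 e2 e3
    proof -
      have "G (- e1, - e2, - e3) = - G (e1, e2, e3)"
        by (simp add: G_def scaleR_add_right scaleR_diff_right)
      then show ?thesis
        using sym that by simp
    qed
    from this[of 1 1 1] this[of 1 1 "- 1"] this[of 1 "- 1" 1] this[of "- 1" 1 1]
    have "is_normal (G (1, 1, 1)) \<Longrightarrow> is_normal (G (- 1, - 1, - 1))"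
      "is_normal (G (1, 1, - 1)) \<Longrightarrow> is_normal (G (- 1, - 1, 1))"
      "is_normal (G (1, - 1, 1)) \<Longrightarrow> is_normal (G (- 1, 1, - 1))"
      "is_normal (G (- 1, 1, 1)) \<Longrightarrow> is_normal (G (1, - 1, - 1))"
      by simp_all
    ultimately show "m \<in> Collect is_normal" if "m \<in> G ` ?E" for m
      using that by auto
  qed
  show "card (Collect is_normal) = 8"
    unfolding N card_image[OF inj] by (simp add: card_cartesian_product)
  have "inner_products = {m \<bullet> m' | m m'. m \<in> G ` ?E \<and> m' \<in> G ` ?E \<and> m \<noteq> m'}"
    unfolding inner_products_def N[symmetric] by simp
  also have "\<dots> = {G e \<bullet> G f | e f. e \<in> ?E \<and> f \<in> ?E \<and> e \<noteq> f}"
    by (rule distinct_pairs_image[OF inj])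
  also have "\<dots> = {1 / 3, - 1 / 3, - 1}"
  proof (intro equalityI subsetI)
    fix x assume "x \<in> {G e \<bullet> G f | e f. e \<in> ?E \<and> f \<in> ?E \<and> e \<noteq> f}"
    then show "x \<in> {1 / 3, - 1 / 3, - 1}"
      by (auto simp: GG)
  next
    let ?X = "{G e \<bullet> G f | e f. e \<in> ?E \<and> f \<in> ?E \<and> e \<noteq> f}"
    have pair: "G e \<bullet> G f \<in> ?X" if "e \<in> ?E" "f \<in> ?E" "e \<noteq> f" for e f
      using that by blast
    have "G (1, 1, 1) \<bullet> G (1, 1, - 1) \<in> ?X" "G (1, 1, 1) \<bullet> G (1, - 1, - 1) \<in> ?X"
      "G (1, 1, 1) \<bullet> G (- 1, - 1, - 1) \<in> ?X"
      by (rule pair; simp)+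
    moreover have "G (1, 1, 1) \<bullet> G (1, 1, - 1) = 1 / 3" "G (1, 1, 1) \<bullet> G (1, - 1, - 1) = - 1 / 3"
      "G (1, 1, 1) \<bullet> G (- 1, - 1, - 1) = - 1"
      by (simp_all add: GG)
    ultimately have "1 / 3 \<in> ?X" "- 1 / 3 \<in> ?X" "- 1 \<in> ?X"
      by (simp_all only:)
    then show "x \<in> ?X" if "x \<in> {1 / 3, - 1 / 3, - 1}" for x
      using that by (elim insertE emptyE) (simp_all only:)
  qed
  finally show "card inner_products = 3"
    by simp
qed

section \<open>The five solids\<close>

lemma pentagon_cos:
  assumes "p = 5"
  shows "(2 * C)\<^sup>2 + 2 * C = 1"
proof -
  have "cos (real i * (2 * pi / 5)) \<noteq> 1" if "0 < i" "i < 5" for i :: nat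
  proof
    assume "cos (real i * (2 * pi / 5)) = 1"
    then obtain k :: int where "real i * (2 * pi / 5) = of_int k * 2 * pi"
      by (auto simp: cos_one_2pi_int)
    then have "real_of_int (int i) = real_of_int (5 * k)"
      by simp
    then have "int i = 5 * k"
      by linarith
    then show False
      using that by presburger
  qed
  then show ?thesis
    unfolding C_def unfolding assms using cos_primitive_root(3)[of 5 "2 * pi / 5"] by simp
qed

end

lemma regular_polyhedron_solid:
  assumes "regular_polyhedron p q Q" "circumscribed_about Q z 1"
  obtains r where "regular_solid Q z p q r"
  using assms unfolding regular_polyhedron_def regular_solid_def by blast

theorem corollary4p6:
  fixes Q :: "(real^3) set" and z :: "real^3" and F k :: nat
  assumes "regular_3_polytope Q"
    and "F = card {f. f facet_of Q}"
    and "circumscribed_about Q z 1"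
    and "k = card (facet_center_distances Q)"
  shows "(regular_tetrahedron Q \<longrightarrow> (\<Sum>t\<in>facet_center_distances Q. t\<^sup>2) \<in> \<rat>) \<and>
    (regular_octahedron Q \<or> regular_cube Q \<longrightarrow>
       (\<Sum>t\<in>facet_center_distances Q. t\<^sup>2) = real F) \<and>
    (regular_icosahedron Q \<or> regular_dodecahedron Q \<longrightarrow>
       (\<Sum>t\<in>facet_center_distances Q. t\<^sup>2) = 2 * real k + 2)"
proof (intro conjI impI; (elim disjE)?)
  assume "regular_tetrahedron Q"
  then obtain r where "regular_solid Q z 3 3 r"
    using regular_polyhedron_solid[of 3 3 Q z] assms(3) by (auto simp: regular_tetrahedron_def)
  then interpret regular_solid Q z 3 3 r .
  have "\<Sum>inner_products \<in> \<rat>"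
    using tetrahedron_inner_products by (auto dest!: subset_singletonD)
  then show "(\<Sum>t\<in>facet_center_distances Q. t\<^sup>2) \<in> \<rat>"
    by (simp add: sum_distances)
next
  assume "regular_octahedron Q"
  then obtain r where "regular_solid Q z 3 4 r"
    using regular_polyhedron_solid[of 3 4 Q z] assms(3) by (auto simp: regular_octahedron_def)
  then interpret regular_solid Q z 3 4 r .
  have "t = 0"
    using triangle_values(1) \<tau>_value(2) by (simp add: t_def)
  then have "(\<Sum>t\<in>facet_center_distances Q. t\<^sup>2) = 2 * real 3 + 2"
    using sum_distances_symmetric normals_symmetric octahedron_normals(2) by (simp add: card_distances)
  then show "(\<Sum>t\<in>facet_center_distances Q. t\<^sup>2) = real F"
    using octahedron_normals(1) bij_betw_same_card[OF normal_facet_bij] assms(2) by simp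
next
  assume "regular_cube Q"
  then obtain r where "regular_solid Q z 4 3 r"
    using regular_polyhedron_solid[of 4 3 Q z] assms(3) by (auto simp: regular_cube_def)
  then interpret regular_solid Q z 4 3 r .
  have "t = 0"
    unfolding t_def C_def using \<tau>_value(1) by simp
  then have "(\<Sum>t\<in>facet_center_distances Q. t\<^sup>2) = 2 * real 2 + 2"
    using sum_distances_symmetric normals_symmetric cube_normals(2) by (simp add: card_distances)
  then show "(\<Sum>t\<in>facet_center_distances Q. t\<^sup>2) = real F"
    using cube_normals(1) bij_betw_same_card[OF normal_facet_bij] assms(2) by simp
next
  assume "regular_icosahedron Q"
  then obtain r where "regular_solid Q z 3 5 r"
    using regular_polyhedron_solid[of 3 5 Q z] assms(3) by (auto simp: regular_icosahedron_def)
  then interpret regular_solid Q z 3 5 r .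
  have "t = \<tau>"
    using triangle_values(1) by (simp add: t_def)
  then have "t\<^sup>2 + t = 1"
    using \<tau>_value(3) by simp
  then show "(\<Sum>t\<in>facet_center_distances Q. t\<^sup>2) = 2 * real k + 2"
    using sum_distances_symmetric normals_symmetric assms(4) by blast
next
  assume "regular_dodecahedron Q"
  then obtain r where "regular_solid Q z 5 3 r"
    using regular_polyhedron_solid[of 5 3 Q z] assms(3) by (auto simp: regular_dodecahedron_def)
  then interpret regular_solid Q z 5 3 r .
  have "t = 2 * C"
    using \<tau>_value(1) by (simp add: t_def)
  then have "t\<^sup>2 + t = 1"
    using pentagon_cos by simp
  then show "(\<Sum>t\<in>facet_center_distances Q. t\<^sup>2) = 2 * real k + 2"
    using sum_distances_symmetric normals_symmetric assms(4) by blast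
qed

end
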